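(* Let $V$ be a nonzero (nowhere vanishing) $C^\infty$ vector field, $D$ a positive $C^\infty$ function, and $H$ a $C^\infty$ function on an open neighborhood $U$ of a point $p$ in the $(\xi,\eta)$ plane. Suppose $D$ satisfies the equations $$DD''=2(D'-1)(D'-2)+(H^2+P(H))D^2,$$ $$L_VP=-\Big(\frac{2-D'}{D}\Big)P+HV$$ for a nonzero $C^\infty$ vector field $P$, transversal to $V$, such that $(V,P)$ has the same orientation as $(\partial_\xi,\partial_\eta)$, where $D'=V(D)$, $D''=V(V(D))$ and $L_V$ is the Lie derivative in the direction $V$. Then in a perhaps smaller neighborhood $U'\subset U$ of $p$: (1) There exist a $C^\infty$ orientation-preserving diffeomorphism $(\xi,\eta)\mapsto(x=x(\xi,\eta),y=y(\xi,\eta))$ from $U'$ onto its image in $\mathbb{R}^2$ and a $C^\infty$ function $\theta=\theta(\xi,\eta)$ on $U'$ such that $$V(\theta)=-H,\qquad V(x)=\sin\theta,\qquad V(y)=-\cos\theta .$$ In addition, the vector field $N$ satisfying $N(x)=\cos\theta$, $N(y)=\sin\theta$ is equal to $P$ and has the property that $$N(\theta)=\frac{2-V(D)}{D}.$$ (2) Moreover, there exists a $C^\infty$ function $z=z(\xi,\eta)$ on $U'$ giving a $C^\infty$ embedding $(\xi,\eta)\in U'\mapsto(x(\xi,\eta),y(\xi,\eta),z(\xi,\eta))\in\boldsymbol{H}_1$ such that the image is a $C^\infty$ graph $z=u(x,y)$, $D=\sqrt{(u_x-y)^2+(u_y+x)^2}$, $N=\frac{(u_x-y,\,u_y+x)}{D}$,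 and $$\operatorname{div}N=H,\qquad \operatorname{div}(DV)=2,$$ where $\operatorname{div}$ denotes the divergence operator in the $x,y$ coordinates.
   Context: $\boldsymbol{H}_1$ is the 3-dimensional Heisenberg group, i.e. $\mathbb{R}^3$ with coordinates $(x,y,z)$ and contact form $dz+x\,dy-y\,dx$. Vector fields on $U'$ are identified with vector fields in the $(x,y)$-plane via the diffeomorphism, so $V=(\sin\theta,-\cos\theta)$ and $N=(\cos\theta,\sin\theta)$ in the $x,y$ coordinates. *)

theory Defs
  imports "HOL-Analysis.Analysis"
begin

text \<open>
  The planes with coordinates \<open>(\<xi>, \<eta>)\<close> and \<open>(x, y)\<close> are both \<open>real \<times> real\<close>. A vector field
  \<open>a \<partial>\<^sub>\<xi> + b \<partial>\<^sub>\<eta>\<close> is the map \<open>q \<mapsto> (a q, b q)\<close>, so that \<open>(\<partial>\<^sub>\<xi>, \<partial>\<^sub>\<eta>)\<close> is the standard basis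
  \<open>(1, 0), (0, 1)\<close>. All functions are total; only their values on the open set under
  consideration matter.
\<close>

fun Ck_on :: "nat \<Rightarrow> 'a::real_normed_vector set \<Rightarrow> ('a \<Rightarrow> 'b::real_normed_vector) \<Rightarrow> bool" where
  "Ck_on 0 S f \<longleftrightarrow> continuous_on S f"
| "Ck_on (Suc k) S f \<longleftrightarrow> (\<forall>q\<in>S. f differentiable (at q)) \<and>
     (\<forall>v. Ck_on k S (\<lambda>q. frechet_derivative f (at q) v))"

text \<open>Meant for open \<open>S\<close> and finite-dimensional \<open>'a\<close>: all iterated directional derivatives exist
  and are continuous on \<open>S\<close>.\<close>

definition smooth_on :: "'a::real_normed_vector set \<Rightarrow> ('a \<Rightarrow> 'b::real_normed_vector) \<Rightarrow> bool" where
  "smooth_on S f \<longleftrightarrow> (\<forall>k. Ck_on k S f)"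

definition deriv_along ::
  "('a::real_normed_vector \<Rightarrow> 'a) \<Rightarrow> ('a \<Rightarrow> 'b::real_normed_vector) \<Rightarrow> 'a \<Rightarrow> 'b" where
  "deriv_along X f q = frechet_derivative f (at q) (X q)"

text \<open>The Lie derivative of a vector field is the bracket \<open>[X, Y]\<close>. Its components in the standard
  coordinates are \<open>X(Y\<^sup>i) - Y(X\<^sup>i)\<close>; the lemma \<open>lie_derivative_commutator\<close> below shows that it is
  the commutator of \<open>X\<close> and \<open>Y\<close> as derivations.\<close>

definition lie_derivative ::
  "('a::real_normed_vector \<Rightarrow> 'a) \<Rightarrow> ('a \<Rightarrow> 'a) \<Rightarrow> 'a \<Rightarrow> 'a" where
  "lie_derivative X Y q = deriv_along X Y q - deriv_along Y X q"

definition det2 :: "real \<times> real \<Rightarrow> real \<times> real \<Rightarrow> real" where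
  "det2 v w = fst v * snd w - snd v * fst w"

definition same_orientation :: "(real \<times> real) \<times> (real \<times> real) \<Rightarrow> (real \<times> real) \<times> (real \<times> real) \<Rightarrow> bool" where
  "same_orientation = (\<lambda>(v, w) (v', w'). det2 v w * det2 v' w' > 0)"

definition transversal :: "real \<times> real \<Rightarrow> real \<times> real \<Rightarrow> bool" where
  "transversal v w \<longleftrightarrow> span {v, w} = UNIV"

definition diffeomorphism_onto_image ::
  "'a::real_normed_vector set \<Rightarrow> ('a \<Rightarrow> 'b::real_normed_vector) \<Rightarrow> bool" where
  "diffeomorphism_onto_image U \<phi> \<longleftrightarrow> open (\<phi> ` U) \<and> smooth_on U \<phi> \<and> inj_on \<phi> U \<and>
     smooth_on (\<phi> ` U) (inv_into U \<phi>)"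

definition orientation_preserving_on :: "(real \<times> real) set \<Rightarrow> (real \<times> real \<Rightarrow> real \<times> real) \<Rightarrow> bool" where
  "orientation_preserving_on U \<phi> \<longleftrightarrow> (\<forall>q\<in>U.
     same_orientation (frechet_derivative \<phi> (at q) (1, 0), frechet_derivative \<phi> (at q) (0, 1))
       ((1, 0), (0, 1)))"

definition smooth_embedding_on ::
  "'a::real_normed_vector set \<Rightarrow> ('a \<Rightarrow> 'b::real_normed_vector) \<Rightarrow> bool" where
  "smooth_embedding_on U F \<longleftrightarrow> smooth_on U F \<and> (\<forall>q\<in>U. inj (frechet_derivative F (at q))) \<and>
     (\<exists>G. homeomorphism U (F ` U) F G)"

text \<open>The vector field on \<open>\<phi> ` U\<close> that a vector field \<open>X\<close> on \<open>U\<close> is identified with via a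
  diffeomorphism \<open>\<phi>\<close>.\<close>

definition pushforward ::
  "'a::real_normed_vector set \<Rightarrow> ('a \<Rightarrow> 'b::real_normed_vector) \<Rightarrow> ('a \<Rightarrow> 'a) \<Rightarrow> 'b \<Rightarrow> 'b" where
  "pushforward U \<phi> X w = deriv_along X \<phi> (inv_into U \<phi> w)"

definition partial_x :: "(real \<times> real \<Rightarrow> real) \<Rightarrow> real \<times> real \<Rightarrow> real" where
  "partial_x f w = frechet_derivative f (at w) (1, 0)"

definition partial_y :: "(real \<times> real \<Rightarrow> real) \<Rightarrow> real \<times> real \<Rightarrow> real" where
  "partial_y f w = frechet_derivative f (at w) (0, 1)"

definition divergence :: "(real \<times> real \<Rightarrow> real \<times> real) \<Rightarrow> real \<times> real \<Rightarrow> real" where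
  "divergence X w = partial_x (\<lambda>r. fst (X r)) w + partial_y (\<lambda>r. snd (X r)) w"

text \<open>The manifold underlying the Heisenberg group. The contact form \<open>dz + x dy - y dx\<close> takes the
  values \<open>u\<^sub>x - y\<close> and \<open>u\<^sub>y + x\<close> on the tangent vectors \<open>(1, 0, u\<^sub>x)\<close> and \<open>(0, 1, u\<^sub>y)\<close> of a graph
  \<open>z = u(x, y)\<close>.\<close>

type_synonym heisenberg = "real \<times> real \<times> real"

lemma double_difference_mvt:
  fixes f :: "'a::real_normed_vector \<Rightarrow> real"
  assumes f: "\<And>s t. s \<in> {0..h} \<Longrightarrow> t \<in> {0..h} \<Longrightarrow> f differentiable (at (x + t *\<^sub>R u + s *\<^sub>R v))"
    and f': "\<And>s t. s \<in> {0..h} \<Longrightarrow> t \<in> {0..h} \<Longrightarrow>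
      (\<lambda>q. frechet_derivative f (at q) u) differentiable (at (x + t *\<^sub>R u + s *\<^sub>R v))"
    and h: "0 < h"
  shows "\<exists>s\<in>{0..h}. \<exists>t\<in>{0..h}.
    f (x + h *\<^sub>R u + h *\<^sub>R v) - f (x + h *\<^sub>R u) - f (x + h *\<^sub>R v) + f x =
    h * (h * frechet_derivative (\<lambda>q. frechet_derivative f (at q) u) (at (x + t *\<^sub>R u + s *\<^sub>R v)) v)"
proof -
  define D where "D q = frechet_derivative f (at q)" for q
  define g where "g t = f (x + t *\<^sub>R u + h *\<^sub>R v) - f (x + t *\<^sub>R u)" for t
  have fd: "(f has_derivative D (x + t *\<^sub>R u + s *\<^sub>R v)) (at (x + t *\<^sub>R u + s *\<^sub>R v))"
    if "s \<in> {0..h}" "t \<in> {0..h}" for s t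
    unfolding D_def using f[OF that] by (simp add: frechet_derivative_works)
  have lin: "linear (D (x + t *\<^sub>R u + s *\<^sub>R v))" if "s \<in> {0..h}" "t \<in> {0..h}" for s t
    using fd[OF that] by (rule has_derivative_linear)
  have 1: "((\<lambda>t. f (x + t *\<^sub>R u + s *\<^sub>R v)) has_real_derivative D (x + t *\<^sub>R u + s *\<^sub>R v) u) (at t)"
    if st: "s \<in> {0..h}" "t \<in> {0..h}" for s t
  proof -
    have "((\<lambda>t. x + t *\<^sub>R u + s *\<^sub>R v) has_derivative (\<lambda>d. d *\<^sub>R u)) (at t)"
      by (auto intro!: derivative_eq_intros)
    from has_derivative_compose[OF this fd[OF st]]
    show ?thesis
      using linear_scale[OF lin[OF st]] by (simp add: has_field_derivative_def mult_commute_abs)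
  qed
  have "\<And>t. 0 \<le> t \<Longrightarrow> t \<le> h \<Longrightarrow>
      (g has_real_derivative D (x + t *\<^sub>R u + h *\<^sub>R v) u - D (x + t *\<^sub>R u) u) (at t)"
    unfolding g_def using 1[of h] 1[of 0] h by (auto intro!: DERIV_diff)
  from MVT2[OF h this] obtain t where t: "0 < t" "t < h"
    and gt: "g h - g 0 = (h - 0) * (D (x + t *\<^sub>R u + h *\<^sub>R v) u - D (x + t *\<^sub>R u) u)" by blast
  define E where "E q = frechet_derivative (\<lambda>q. D q u) (at q)" for q
  have "((\<lambda>s. D (x + t *\<^sub>R u + s *\<^sub>R v) u) has_real_derivative E (x + t *\<^sub>R u + s *\<^sub>R v) v) (at s)"
    if "0 \<le> s" "s \<le> h" for s
  proof -
    have st: "s \<in> {0..h}" "t \<in> {0..h}" using that t by auto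
    have Ed: "((\<lambda>q. D q u) has_derivative E (x + t *\<^sub>R u + s *\<^sub>R v)) (at (x + t *\<^sub>R u + s *\<^sub>R v))"
      unfolding E_def using f'[OF st] by (simp add: frechet_derivative_works D_def)
    have "((\<lambda>s. x + t *\<^sub>R u + s *\<^sub>R v) has_derivative (\<lambda>d. d *\<^sub>R v)) (at s)"
      by (auto intro!: derivative_eq_intros)
    from has_derivative_compose[OF this Ed]
    show ?thesis
      using linear_scale[OF has_derivative_linear[OF Ed]]
      by (simp add: has_field_derivative_def mult_commute_abs)
  qed
  from MVT2[OF h this] obtain s where s: "0 < s" "s < h"
    and "D (x + t *\<^sub>R u + h *\<^sub>R v) u - D (x + t *\<^sub>R u + 0 *\<^sub>R v) u = (h - 0) * E (x + t *\<^sub>R u + s *\<^sub>R v) v"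
    by blast
  with gt have "g h - g 0 = h * (h * E (x + t *\<^sub>R u + s *\<^sub>R v) v)" by simp
  then have "f (x + h *\<^sub>R u + h *\<^sub>R v) - f (x + h *\<^sub>R u) - f (x + h *\<^sub>R v) + f x =
      h * (h * E (x + t *\<^sub>R u + s *\<^sub>R v) v)"
    by (simp add: g_def)
  then show ?thesis
    using s t unfolding E_def D_def by (intro bexI[of _ s] bexI[of _ t]) auto
qed

lemma symmetric_second_derivative:
  fixes f :: "'a::real_normed_vector \<Rightarrow> real"
  assumes U: "open U" "x \<in> U" and f: "Ck_on 2 U f"
  shows "frechet_derivative (\<lambda>q. frechet_derivative f (at q) u) (at x) v =
         frechet_derivative (\<lambda>q. frechet_derivative f (at q) v) (at x) u"
proof (rule ccontr)
  define A where "A q = frechet_derivative (\<lambda>q. frechet_derivative f (at q) u) (at q) v" for q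
  define B where "B q = frechet_derivative (\<lambda>q. frechet_derivative f (at q) v) (at q) u" for q
  assume "\<not> ?thesis"
  then have ne: "A x \<noteq> B x" by (simp add: A_def B_def)
  define e where "e = \<bar>A x - B x\<bar> / 2"
  have e: "e > 0" using ne by (simp add: e_def)
  have "Ck_on (Suc (Suc 0)) U f" using f by (simp add: numeral_2_eq_2)
  then have d1: "\<And>q. q \<in> U \<Longrightarrow> f differentiable (at q)"
    and d2: "\<And>q w. q \<in> U \<Longrightarrow> (\<lambda>q. frechet_derivative f (at q) w) differentiable (at q)"
    and "continuous_on U A" "continuous_on U B"
    by (auto simp: A_def B_def)
  then have "isCont A x" "isCont B x"
    using U by (auto simp: continuous_on_eq_continuous_at)
  then obtain d1 d2 where "d1 > 0" "d2 > 0"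
    and dA: "\<And>q. dist q x < d1 \<Longrightarrow> dist (A q) (A x) < e"
    and dB: "\<And>q. dist q x < d2 \<Longrightarrow> dist (B q) (B x) < e"
    using e unfolding continuous_at_eps_delta by blast
  moreover obtain d0 where "d0 > 0" "ball x d0 \<subseteq> U"
    using U open_contains_ball by blast
  moreover define d where "d = min d0 (min d1 d2)"
  ultimately have d: "d > 0" "d \<le> d1" "d \<le> d2" "ball x d \<subseteq> U" by auto
  define h where "h = d / (norm u + norm v + 1)"
  have pos: "norm u + norm v + 1 > 0" by (smt (verit) norm_ge_zero)
  have h: "h > 0" using d pos by (simp add: h_def)
  have near: "dist (x + t *\<^sub>R u + s *\<^sub>R v) x < d" if "s \<in> {0..h}" "t \<in> {0..h}" for s t
  proof -
    have "dist (x + t *\<^sub>R u + s *\<^sub>R v) x \<le> t * norm u + s * norm v"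
      using that norm_triangle_ineq[of "t *\<^sub>R u" "s *\<^sub>R v"] by (simp add: dist_norm add.assoc)
    also have "\<dots> \<le> h * norm u + h * norm v"
      using that by (intro add_mono mult_right_mono) auto
    also have "\<dots> < h * (norm u + norm v + 1)" using h by (simp add: algebra_simps)
    also have "\<dots> = d" using pos by (simp add: h_def)
    finally show ?thesis .
  qed
  then have inU: "x + t *\<^sub>R u + s *\<^sub>R v \<in> U" if "s \<in> {0..h}" "t \<in> {0..h}" for s t
    using that d(4) by (metis dist_commute mem_ball subsetD)
  have inU': "x + t *\<^sub>R v + s *\<^sub>R u \<in> U" if "s \<in> {0..h}" "t \<in> {0..h}" for s t
    using inU[OF that(2,1)] by (simp add: algebra_simps)
  obtain s t where st: "s \<in> {0..h}" "t \<in> {0..h}" and eA: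
    "f (x + h *\<^sub>R u + h *\<^sub>R v) - f (x + h *\<^sub>R u) - f (x + h *\<^sub>R v) + f x =
      h * (h * A (x + t *\<^sub>R u + s *\<^sub>R v))"
    using double_difference_mvt[OF d1[OF inU] d2[OF inU] h] unfolding A_def by blast
  obtain s' t' where st': "s' \<in> {0..h}" "t' \<in> {0..h}" and eB:
    "f (x + h *\<^sub>R v + h *\<^sub>R u) - f (x + h *\<^sub>R v) - f (x + h *\<^sub>R u) + f x =
      h * (h * B (x + t' *\<^sub>R v + s' *\<^sub>R u))"
    using double_difference_mvt[OF d1[OF inU'] d2[OF inU'] h] unfolding B_def by blast
  have AB: "A (x + t *\<^sub>R u + s *\<^sub>R v) = B (x + t' *\<^sub>R v + s' *\<^sub>R u)"
    using eA eB h by (simp add: algebra_simps)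
  have "dist (A (x + t *\<^sub>R u + s *\<^sub>R v)) (A x) < e"
    using near[OF st] d by (intro dA) auto
  moreover have "dist (A (x + t *\<^sub>R u + s *\<^sub>R v)) (B x) < e"
    unfolding AB using near[OF st'(2,1)] d by (intro dB) (auto simp: algebra_simps)
  ultimately have "dist (A x) (B x) < e + e"
    using dist_triangle3[of "A x" "B x" "A (x + t *\<^sub>R u + s *\<^sub>R v)"] by linarith
  then show False
    by (simp add: e_def dist_real_def)
qed

lemma lie_derivative_commutator:
  fixes X Y :: "real \<times> real \<Rightarrow> real \<times> real" and f :: "real \<times> real \<Rightarrow> real"
  assumes U: "open U" "q \<in> U" and X: "smooth_on U X" and Y: "smooth_on U Y" and f: "smooth_on U f"
  shows "deriv_along (lie_derivative X Y) f q =
    deriv_along X (deriv_along Y f) q - deriv_along Y (deriv_along X f) q"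
proof -
  define f1 where "f1 r = frechet_derivative f (at r) (1, 0)" for r
  define f2 where "f2 r = frechet_derivative f (at r) (0, 1)" for r
  have C2: "Ck_on 2 U f" using f by (simp add: smooth_on_def)
  then have "Ck_on (Suc (Suc 0)) U f" by (simp add: numeral_2_eq_2)
  then have df: "\<And>r. r \<in> U \<Longrightarrow> f differentiable (at r)"
    and df1: "f1 differentiable (at q)" and df2: "f2 differentiable (at q)"
    using U by (auto simp: f1_def[abs_def] f2_def[abs_def])
  have split: "L w = fst w * L (1, 0) + snd w * L (0, 1)" if "linear L"
    for L :: "real \<times> real \<Rightarrow> real" and w
  proof -
    have "w = fst w *\<^sub>R (1, 0) + snd w *\<^sub>R (0, 1)" by (simp add: prod_eq_iff)
    then have "L w = L (fst w *\<^sub>R (1, 0) + snd w *\<^sub>R (0, 1))" by (rule arg_cong[of _ _ L])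
    also have "\<dots> = fst w * L (1, 0) + snd w * L (0, 1)"
      unfolding linear_add[OF that] linear_scale[OF that] by simp
    finally show ?thesis .
  qed
  have lin: "linear (frechet_derivative g (at r))" if "g differentiable (at r)"
    for g :: "real \<times> real \<Rightarrow> real" and r
    using that by (simp add: linear_frechet_derivative)
  have along: "deriv_along Z f r = fst (Z r) * f1 r + snd (Z r) * f2 r" if "r \<in> U" for Z r
    unfolding deriv_along_def f1_def f2_def using split[OF lin[OF df[OF that]]] .
  define G where "G i = frechet_derivative (if i then f1 else f2) (at q)" for i
  have twice: "deriv_along Z (deriv_along W f) q =
      fst (deriv_along Z W q) * f1 q + fst (W q) * G True (Z q) +
      (snd (deriv_along Z W q) * f2 q + snd (W q) * G False (Z q))"
    if W: "smooth_on U W" for Z W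
  proof -
    have "Ck_on (Suc 0) U W" using W by (simp add: smooth_on_def)
    then have dW: "(W has_derivative frechet_derivative W (at q)) (at q)"
      using U by (simp add: frechet_derivative_works)
    have "((\<lambda>r. fst (W r) * f1 r + snd (W r) * f2 r) has_derivative
       (\<lambda>w. (fst (W q) * G True w + fst (frechet_derivative W (at q) w) * f1 q) +
            (snd (W q) * G False w + snd (frechet_derivative W (at q) w) * f2 q))) (at q)"
      using df1 df2 unfolding G_def
      by (intro has_derivative_add has_derivative_mult has_derivative_fst has_derivative_snd dW)
         (auto simp: frechet_derivative_works)
    then have "(deriv_along W f has_derivative
       (\<lambda>w. (fst (W q) * G True w + fst (frechet_derivative W (at q) w) * f1 q) +
            (snd (W q) * G False w + snd (frechet_derivative W (at q) w) * f2 q))) (at q)"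
      by (rule has_derivative_transform_within_open[OF _ U]) (simp add: along)
    from frechet_derivative_at[OF this, symmetric]
    show ?thesis
      unfolding deriv_along_def[of Z] by (simp add: algebra_simps)
  qed
  have sym: "G True (0, 1) = G False (1, 0)"
    using symmetric_second_derivative[OF U C2, of "(1, 0)" "(0, 1)"]
    by (simp add: G_def f1_def[abs_def] f2_def[abs_def])
  have G: "G True w = fst w * G True (1, 0) + snd w * G True (0, 1)"
    "G False w = fst w * G False (1, 0) + snd w * G False (0, 1)" for w
    using split[OF lin[OF df1], of w] split[OF lin[OF df2], of w] by (simp_all only: G_def if_True if_False)
  show ?thesis
    unfolding twice[OF X] twice[OF Y] along[OF U(2)] G[of "X q"] G[of "Y q"] sym
    by (simp add: lie_derivative_def algebra_simps)
qed

end

theory Submission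
  imports Defs
begin

text \<open>
  Put \<open>g = (2 - V(D)) / D\<close>, so that \<open>[V, P] = -g P + H V\<close>. A system \<open>V f = a, P f = b\<close> is solvable
  on a ball as soon as the 1-form with these values on the frame is closed, that is
  \<open>V b - P a = -g b + H a\<close>. The equation for \<open>D\<close> reads \<open>V g + P H + g\<^sup>2 + H\<^sup>2 = 0\<close>, which is this condition
  for \<open>V \<theta> = -H, P \<theta> = g\<close>. Given \<open>\<theta>\<close>, it also holds for \<open>V x = sin \<theta>, P x = cos \<theta>\<close>, for
  \<open>V y = -cos \<theta>, P y = sin \<theta>\<close>, and then for the function \<open>z\<close> whose contact form pulls back to
  \<open>D (cos \<theta> dx + sin \<theta> dy)\<close>. The map \<open>(x, y)\<close> takes \<open>(V, P)\<close> to an oriented orthonormal frame, hence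
  is a local diffeomorphism, and \<open>div N = -V \<theta> = H\<close>, \<open>div (D V) = V D + D (P \<theta>) = 2\<close>.
\<close>

subsection \<open>Calculus of smooth maps\<close>

lemma Ck_on_has_derivative:
  assumes "Ck_on (Suc k) S f" "q \<in> S"
  shows "(f has_derivative frechet_derivative f (at q)) (at q)"
  using assms by (simp add: frechet_derivative_works)

text \<open>All functions are total, so a change off \<open>S\<close> must be harmless. Openness of
  \<open>S\<close> makes the derivatives at points of \<open>S\<close> agree as well, and the
  induction passes to them.\<close>

lemma Ck_on_cong:
  assumes "open S" "Ck_on k S f" "\<And>q. q \<in> S \<Longrightarrow> f q = g q"
  shows "Ck_on k S g"
  using assms(2,3)
proof (induction k arbitrary: f g)
  case 0
  then show ?case by (simp cong: continuous_on_cong)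
next
  case (Suc k)
  have eq: "frechet_derivative f (at q) = frechet_derivative g (at q)" if "q \<in> S" for q
    using Suc.prems that by (intro frechet_derivative_transform_within_open[OF _ assms(1)]) auto
  have "g differentiable (at q)" if "q \<in> S" for q
    using has_derivative_transform_within_open[OF Ck_on_has_derivative[OF Suc.prems(1) that] assms(1) that]
      Suc.prems(2) by (auto simp: differentiable_def)
  moreover have "Ck_on k S (\<lambda>q. frechet_derivative g (at q) v)" for v
    by (rule Suc.IH[of "\<lambda>q. frechet_derivative f (at q) v"]) (use Suc.prems eq in auto)
  ultimately show ?case by simp
qed

text \<open>Derivatives at a point are unique, so any explicit family \<open>f'\<close> may stand in
  for \<open>frechet_derivative\<close>. The later regularity inductions all enter the successor
  case this way.\<close>

lemma Ck_on_SucI: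
  assumes "open S" and f': "\<And>q. q \<in> S \<Longrightarrow> (f has_derivative f' q) (at q)"
    and "\<And>v. Ck_on k S (\<lambda>q. f' q v)"
  shows "Ck_on (Suc k) S f"
proof -
  have "frechet_derivative f (at q) = f' q" if "q \<in> S" for q
    using frechet_derivative_at[OF f'[OF that]] by simp
  then have "Ck_on k S (\<lambda>q. frechet_derivative f (at q) v)" for v
    by (intro Ck_on_cong[OF assms(1,3)]) simp
  then show ?thesis
    using f' by (auto simp: differentiable_def)
qed

text \<open>The successor clause of \<open>Ck_on\<close> does not mention continuity of
  \<open>f\<close> itself; it comes from differentiability in the base case.\<close>

lemma Ck_on_Suc_imp: "Ck_on (Suc k) S f \<Longrightarrow> Ck_on k S f"
proof (induction k arbitrary: f)
  case 0
  then have "\<forall>q\<in>S. isCont f q"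
    by (simp add: differentiable_imp_continuous_within)
  then show ?case
    by (simp add: continuous_at_imp_continuous_on)
next
  case (Suc k)
  then have "\<forall>q\<in>S. f differentiable (at q)"
    and "\<And>v. Ck_on (Suc k) S (\<lambda>q. frechet_derivative f (at q) v)"
    unfolding Ck_on.simps(2)[of "Suc k"] by blast+
  then show ?case
    unfolding Ck_on.simps(2)[of k S f] by (blast intro: Suc.IH)
qed

lemma Ck_on_mono: "Ck_on k S f \<Longrightarrow> T \<subseteq> S \<Longrightarrow> Ck_on k T f"
  by (induction k arbitrary: f) (auto intro: continuous_on_subset)

lemma Ck_on_const: "Ck_on k S (\<lambda>q. c)"
  by (induction k arbitrary: c) (auto simp: frechet_derivative_const)

lemma Ck_on_bounded_linear:
  assumes "bounded_linear L" "open S" "Ck_on k S f"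
  shows "Ck_on k S (\<lambda>q. L (f q))"
  using assms(3)
proof (induction k arbitrary: f)
  case 0
  then show ?case using assms(1) by (simp add: bounded_linear.continuous_on)
next
  case (Suc k)
  show ?case
    by (rule Ck_on_SucI[OF assms(2)
          bounded_linear.has_derivative[OF assms(1) Ck_on_has_derivative[OF Suc.prems]]])
       (use Suc assms in auto)
qed

lemma Ck_on_add:
  assumes "open S" "Ck_on k S f" "Ck_on k S g"
  shows "Ck_on k S (\<lambda>q. f q + g q)"
  using assms(2,3)
proof (induction k arbitrary: f g)
  case 0
  then show ?case by (simp add: continuous_on_add)
next
  case (Suc k)
  show ?case
    by (rule Ck_on_SucI[OF assms(1)
          has_derivative_add[OF Ck_on_has_derivative[OF Suc.prems(1)] Ck_on_has_derivative[OF Suc.prems(2)]]])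
       (use Suc assms in auto)
qed

lemma Ck_on_bounded_bilinear:
  assumes "bounded_bilinear b" "open S" "Ck_on k S f" "Ck_on k S g"
  shows "Ck_on k S (\<lambda>q. b (f q) (g q))"
  using assms(3,4)
proof (induction k arbitrary: f g)
  case 0
  then show ?case using assms(1) by (simp add: bounded_bilinear.continuous_on)
next
  case (Suc k)
  \<comment> \<open>Each term of the product rule keeps one factor undifferentiated, so the
    induction hypothesis needs that factor lowered from order \<open>Suc k\<close> to
    \<open>k\<close>.\<close>
  show ?case
    by (rule Ck_on_SucI[OF assms(2) bounded_bilinear.FDERIV[OF assms(1)
            Ck_on_has_derivative[OF Suc.prems(1)] Ck_on_has_derivative[OF Suc.prems(2)]]])
       (use Suc.IH[OF Ck_on_Suc_imp[OF Suc.prems(1)]] Suc.IH[OF _ Ck_on_Suc_imp[OF Suc.prems(2)]]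
          Suc.prems assms(2) in \<open>auto intro!: Ck_on_add\<close>)
qed

lemma Ck_on_sum:
  assumes "open S" "finite I" "\<And>i. i \<in> I \<Longrightarrow> Ck_on k S (f i)"
  shows "Ck_on k S (\<lambda>q. \<Sum>i\<in>I. f i q)"
  using assms(2,3) by (induction I) (auto intro: Ck_on_const Ck_on_add[OF assms(1)])

lemma linear_basis_expansion:
  fixes v :: "'a::euclidean_space"
  assumes "linear L"
  shows "L v = (\<Sum>b\<in>Basis. (v \<bullet> b) *\<^sub>R L b)"
proof -
  have "L v = L (\<Sum>b\<in>Basis. (v \<bullet> b) *\<^sub>R b)"
    by (simp add: euclidean_representation)
  also have "\<dots> = (\<Sum>b\<in>Basis. (v \<bullet> b) *\<^sub>R L b)"
    by (simp add: assms linear_sum linear_scale)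
  finally show ?thesis .
qed

text \<open>\<open>Ck_on\<close> only controls derivatives in a fixed direction. Expanding the
  varying direction \<open>X q\<close> in the finite basis reduces to those.\<close>

lemma Ck_on_frechet_apply:
  fixes g :: "'b::euclidean_space \<Rightarrow> 'c::real_normed_vector"
  assumes "open S" and g: "\<And>y. y \<in> f ` S \<Longrightarrow> g differentiable (at y)"
    and "\<And>b. Ck_on k S (\<lambda>q. frechet_derivative g (at (f q)) b)" "Ck_on k S X"
  shows "Ck_on k S (\<lambda>q. frechet_derivative g (at (f q)) (X q))"
proof (rule Ck_on_cong[OF assms(1)])
  show "Ck_on k S (\<lambda>q. \<Sum>b\<in>Basis. (X q \<bullet> b) *\<^sub>R frechet_derivative g (at (f q)) b)"
    by (intro Ck_on_sum Ck_on_bounded_bilinear[OF bounded_bilinear_scaleR]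
        Ck_on_bounded_linear[OF bounded_linear_inner_left] assms finite_Basis)
  show "(\<Sum>b\<in>Basis. (X q \<bullet> b) *\<^sub>R frechet_derivative g (at (f q)) b) =
      frechet_derivative g (at (f q)) (X q)" if "q \<in> S" for q
    by (rule linear_basis_expansion[OF linear_frechet_derivative[OF g[OF imageI[OF that]]], symmetric])
qed

text \<open>Induction with \<open>f\<close> fixed and \<open>g\<close> arbitrary: by the chain rule
  the derivative is built from the directional derivatives of \<open>g\<close> composed with
  \<open>f\<close>, to which the induction hypothesis applies.\<close>

lemma Ck_on_compose:
  fixes f :: "'a::real_normed_vector \<Rightarrow> 'b::euclidean_space"
  assumes "open S" "f ` S \<subseteq> T" "Ck_on k S f" "Ck_on k T g"
  shows "Ck_on k S (\<lambda>q. g (f q))"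
  using assms(3,4)
proof (induction k arbitrary: g)
  case 0
  then show ?case using assms(2) by (auto intro: continuous_on_compose2)
next
  case (Suc k)
  show ?case
  proof (rule Ck_on_SucI[OF assms(1)])
    show "((\<lambda>q. g (f q)) has_derivative
        (\<lambda>v. frechet_derivative g (at (f q)) (frechet_derivative f (at q) v))) (at q)" if "q \<in> S" for q
      by (rule has_derivative_compose[OF Ck_on_has_derivative[OF Suc.prems(1) that]
            Ck_on_has_derivative[OF Suc.prems(2)]]) (use that assms(2) in auto)
    show "Ck_on k S (\<lambda>q. frechet_derivative g (at (f q)) (frechet_derivative f (at q) v))" for v
    proof (rule Ck_on_frechet_apply[OF assms(1)])
      show "Ck_on k S (\<lambda>q. frechet_derivative g (at (f q)) b)" for b
        using Suc.IH[OF Ck_on_Suc_imp[OF Suc.prems(1)], of "\<lambda>y. frechet_derivative g (at y) b"]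
          Suc.prems(2) by simp
    qed (use Suc.prems assms(2) in auto)
  qed
qed

section \<open>Closure properties of smooth maps\<close>

lemma smooth_on_has_derivative:
  "smooth_on S f \<Longrightarrow> q \<in> S \<Longrightarrow> (f has_derivative frechet_derivative f (at q)) (at q)"
  unfolding smooth_on_def by (auto intro: Ck_on_has_derivative[of 0])

lemma smooth_on_differentiable: "smooth_on S f \<Longrightarrow> q \<in> S \<Longrightarrow> f differentiable (at q)"
  by (simp add: frechet_derivative_works smooth_on_has_derivative)

lemma smooth_on_continuous_on: "smooth_on S f \<Longrightarrow> continuous_on S f"
  by (simp add: smooth_on_def flip: Ck_on.simps(1))

lemma smooth_on_subset: "smooth_on S f \<Longrightarrow> T \<subseteq> S \<Longrightarrow> smooth_on T f"
  by (simp add: smooth_on_def Ck_on_mono[of _ S])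

lemma smooth_on_const: "smooth_on S (\<lambda>q. c)"
  by (simp add: smooth_on_def Ck_on_const)

text \<open>A map is one order more regular than its derivative, so a smooth derivative settles
  every order at once. This is how primitives are seen to be smooth.\<close>

lemma smooth_on_has_derivativeI:
  assumes "open S" "\<And>q. q \<in> S \<Longrightarrow> (f has_derivative f' q) (at q)"
    and "\<And>v. smooth_on S (\<lambda>q. f' q v)"
  shows "smooth_on S f"
  unfolding smooth_on_def
proof
  fix k
  have "Ck_on (Suc k) S f"
    using assms by (intro Ck_on_SucI) (auto simp: smooth_on_def)
  then show "Ck_on k S f" by (rule Ck_on_Suc_imp)
qed

lemma smooth_on_bounded_linear:
  "bounded_linear L \<Longrightarrow> open S \<Longrightarrow> smooth_on S f \<Longrightarrow> smooth_on S (\<lambda>q. L (f q))"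
  by (simp add: smooth_on_def Ck_on_bounded_linear)

lemma smooth_on_bounded_bilinear:
  "bounded_bilinear b \<Longrightarrow> open S \<Longrightarrow> smooth_on S f \<Longrightarrow> smooth_on S g \<Longrightarrow>
    smooth_on S (\<lambda>q. b (f q) (g q))"
  by (simp add: smooth_on_def Ck_on_bounded_bilinear)

lemmas smooth_on_scaleR = smooth_on_bounded_bilinear[OF bounded_bilinear_scaleR]
lemmas smooth_on_mult = smooth_on_bounded_bilinear[OF bounded_bilinear_mult]
lemmas smooth_on_uminus = smooth_on_bounded_linear[OF bounded_linear_minus[OF bounded_linear_ident]]
lemmas smooth_on_fst = smooth_on_bounded_linear[OF bounded_linear_fst]
lemmas smooth_on_snd = smooth_on_bounded_linear[OF bounded_linear_snd]

lemma smooth_on_add: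
  "open S \<Longrightarrow> smooth_on S f \<Longrightarrow> smooth_on S g \<Longrightarrow> smooth_on S (\<lambda>q. f q + g q)"
  by (simp add: smooth_on_def Ck_on_add)

lemma smooth_on_diff:
  "open S \<Longrightarrow> smooth_on S f \<Longrightarrow> smooth_on S g \<Longrightarrow> smooth_on S (\<lambda>q. f q - g q)"
  using smooth_on_add[OF _ _ smooth_on_uminus, of S f g] by simp

lemma smooth_on_Pair:
  assumes "open S" "smooth_on S f" "smooth_on S g"
  shows "smooth_on S (\<lambda>q. (f q, g q))"
proof -
  have "bounded_linear (\<lambda>a :: 'b. (a, 0 :: 'c))" "bounded_linear (\<lambda>b :: 'c. (0 :: 'b, b))"
    by (auto intro!: bounded_linear_Pair bounded_linear_ident bounded_linear_zero)
  from smooth_on_add[OF assms(1) smooth_on_bounded_linear[OF this(1) assms(1,2)]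
      smooth_on_bounded_linear[OF this(2) assms(1,3)]]
  show ?thesis by simp
qed

lemma smooth_on_compose:
  fixes f :: "'a::real_normed_vector \<Rightarrow> 'b::euclidean_space"
  shows "open S \<Longrightarrow> f ` S \<subseteq> T \<Longrightarrow> smooth_on S f \<Longrightarrow> smooth_on T g \<Longrightarrow> smooth_on S (\<lambda>q. g (f q))"
  by (simp add: smooth_on_def Ck_on_compose[of S f T])

lemma smooth_on_deriv_along:
  fixes f :: "'a::euclidean_space \<Rightarrow> 'b::real_normed_vector"
  assumes "open S" "smooth_on S X" "smooth_on S f"
  shows "smooth_on S (deriv_along X f)"
  unfolding smooth_on_def deriv_along_def
proof
  fix k
  have "Ck_on (Suc k) S f" "Ck_on k S X" using assms by (auto simp: smooth_on_def)
  then show "Ck_on k S (\<lambda>q. frechet_derivative f (at q) (X q))"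
    using Ck_on_frechet_apply[OF assms(1), of "\<lambda>q. q" f k X] by simp
qed

lemma smooth_on_sin_cos: "smooth_on UNIV (sin :: real \<Rightarrow> real)" "smooth_on UNIV (cos :: real \<Rightarrow> real)"
proof -
  \<comment> \<open>Sine and cosine are each other's derivatives up to sign, so the induction treats
    both together.\<close>
  have "Ck_on k UNIV (sin :: real \<Rightarrow> real) \<and> Ck_on k UNIV (cos :: real \<Rightarrow> real)" for k
  proof (induction k)
    case 0
    show ?case by (simp add: continuous_on_sin continuous_on_cos)
  next
    case (Suc k)
    have "(sin has_derivative (\<lambda>v. v * cos q)) (at q)"
      "(cos has_derivative (\<lambda>v. - (v * sin q))) (at q)" for q :: real
      by (auto intro!: derivative_eq_intros)
    with Suc show ?case
      by (auto intro!: Ck_on_SucI[where f = sin] Ck_on_SucI[where f = cos]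
          Ck_on_bounded_linear[OF bounded_linear_minus[OF bounded_linear_ident]]
          Ck_on_bounded_bilinear[OF bounded_bilinear_mult] Ck_on_const simp del: Ck_on.simps)
  qed
  then show "smooth_on UNIV (sin :: real \<Rightarrow> real)" "smooth_on UNIV (cos :: real \<Rightarrow> real)"
    by (simp_all add: smooth_on_def)
qed

lemma smooth_on_sin: "open S \<Longrightarrow> smooth_on S f \<Longrightarrow> smooth_on S (\<lambda>q. sin (f q :: real))"
  and smooth_on_cos: "open S \<Longrightarrow> smooth_on S f \<Longrightarrow> smooth_on S (\<lambda>q. cos (f q :: real))"
  using smooth_on_compose[of S f UNIV sin] smooth_on_compose[of S f UNIV cos] smooth_on_sin_cos
  by auto

text \<open>The derivative of the reciprocal is a product of reciprocals and a constant, so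
  regularity of order \<open>k\<close> on the punctured line reproduces itself at order
  \<open>Suc k\<close>. The general case follows by composition.\<close>

lemma smooth_on_inverse:
  fixes f :: "'a::real_normed_vector \<Rightarrow> real"
  assumes "open S" "smooth_on S f" "\<And>q. q \<in> S \<Longrightarrow> f q \<noteq> 0"
  shows "smooth_on S (\<lambda>q. inverse (f q))"
proof -
  have "Ck_on k (- {0}) (inverse :: real \<Rightarrow> real)" for k
  proof (induction k)
    case 0
    show ?case by (auto intro!: continuous_intros)
  next
    case (Suc k)
    show ?case
    proof (rule Ck_on_SucI)
      show "(inverse has_derivative (\<lambda>v. - (inverse q * v * inverse q))) (at q)" if "q \<in> - {0}" for q :: real
        using that by (intro has_derivative_inverse') auto
      show "Ck_on k (- {0}) (\<lambda>q::real. - (inverse q * v * inverse q))" for v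
        by (intro Ck_on_bounded_linear[OF bounded_linear_minus[OF bounded_linear_ident]]
          Ck_on_bounded_bilinear[OF bounded_bilinear_mult] Ck_on_const Suc) auto
    qed auto
  qed
  then show ?thesis
    using assms by (intro smooth_on_compose[of S f "- {0}" inverse]) (auto simp: smooth_on_def)
qed

lemma smooth_on_divide:
  fixes f :: "'a::real_normed_vector \<Rightarrow> real"
  assumes "open S" "smooth_on S f" "smooth_on S g" "\<And>q. q \<in> S \<Longrightarrow> g q \<noteq> 0"
  shows "smooth_on S (\<lambda>q. f q / g q)"
  unfolding divide_inverse by (intro smooth_on_mult smooth_on_inverse assms)

lemmas smooth_on_intros = smooth_on_const smooth_on_add smooth_on_diff smooth_on_uminus smooth_on_mult
  smooth_on_scaleR smooth_on_fst smooth_on_snd smooth_on_Pair smooth_on_sin smooth_on_cos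
  smooth_on_divide smooth_on_deriv_along

subsection \<open>Primitives and local diffeomorphisms\<close>

text \<open>The Poincare lemma on a convex set, with a 1-form represented by the vector field
  \<open>F\<close> through the inner product; symmetry of its derivative is closedness. The
  primitive is the line integral of \<open>F\<close> along segments from a base point
  \<open>p\<close>.\<close>

lemma closed_gradient_has_primitive:
  fixes F :: "'a::euclidean_space \<Rightarrow> 'a"
  assumes B: "open B" "convex B" and F: "Ck_on 1 B F"
    and sym: "\<And>q u v. q \<in> B \<Longrightarrow>
      frechet_derivative F (at q) u \<bullet> v = frechet_derivative F (at q) v \<bullet> u"
  obtains f where "\<And>q. q \<in> B \<Longrightarrow> (f has_derivative (\<lambda>v. F q \<bullet> v)) (at q)"
proof (cases "B = {}")
  case False
  then obtain p where p: "p \<in> B" by blast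
  define F' where "F' q = frechet_derivative F (at q)" for q
  have "Ck_on (Suc 0) B F" using F by simp
  then have F': "(F has_derivative F' q) (at q)" if "q \<in> B" for q
    using Ck_on_has_derivative that unfolding F'_def by blast
  have linF': "linear (F' q)" if "q \<in> B" for q
    using F'[OF that] by (rule has_derivative_linear)
  have contF: "continuous_on B F" and contF': "continuous_on B (\<lambda>q. F' q b)" for b
    using F Ck_on_Suc_imp[of 0 B F] by (simp_all add: F'_def[abs_def])
  define \<gamma> where "\<gamma> q t = p + t *\<^sub>R (q - p)" for q and t :: real
  have \<gamma>: "\<gamma> q t \<in> B" if "q \<in> B" "t \<in> {0..1}" for q t
    using convexD_alt[OF B(2) p that(1), of t] that(2)
    by (simp add: \<gamma>_def algebra_simps)
  \<comment> \<open>Since \<open>F'\<close> is symmetric, \<open>w q t\<close> is both the gradient in \<open>q\<close> of \<open>F (\<gamma> q t) \<bullet> (q - p)\<close> and the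
    derivative in \<open>t\<close> of \<open>t *\<^sub>R F (\<gamma> q t)\<close>. Hence the integral of the former has gradient \<open>F q\<close>.\<close>
  define w where "w q t = t *\<^sub>R F' (\<gamma> q t) (q - p) + F (\<gamma> q t)" for q t
  have cont\<gamma>: "continuous_on (B \<times> {0..1}) (\<lambda>z. \<gamma> (fst z) (snd z))"
    unfolding \<gamma>_def by (intro continuous_intros)
  have contw: "continuous_on (B \<times> {0..1}) (\<lambda>z. w (fst z) (snd z))"
  proof -
    \<comment> \<open>Only continuity of \<open>F'\<close> in fixed directions is known; expanding
      \<open>q - p\<close> in the basis gives joint continuity in \<open>q\<close> and
      \<open>t\<close>.\<close>
    have "continuous_on (B \<times> {0..1}) (\<lambda>z. snd z *\<^sub>R
        (\<Sum>b\<in>Basis. ((fst z - p) \<bullet> b) *\<^sub>R F' (\<gamma> (fst z) (snd z)) b) + F (\<gamma> (fst z) (snd z)))"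
      using \<gamma> by (intro continuous_intros continuous_on_compose2[OF contF' cont\<gamma>]
          continuous_on_compose2[OF contF cont\<gamma>]) auto
    then show ?thesis
      unfolding w_def using linear_basis_expansion[OF linF'[OF \<gamma>]]
      by (auto elim!: continuous_on_eq)
  qed
  have intw: "(w q has_integral F q) {0..1}" if q: "q \<in> B" for q
  proof -
    have "((\<lambda>t. t *\<^sub>R F (\<gamma> q t)) has_vector_derivative w q t) (at t within {0..1})"
      if t: "t \<in> {0..1}" for t
    proof -
      have "(\<gamma> q has_derivative (\<lambda>s. s *\<^sub>R (q - p))) (at t)"
        unfolding \<gamma>_def by (auto intro!: derivative_eq_intros)
      from has_derivative_compose[OF this F'[OF \<gamma>[OF q t]]]
      have "((\<lambda>t. F (\<gamma> q t)) has_derivative (\<lambda>s. s *\<^sub>R F' (\<gamma> q t) (q - p))) (at t)"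
        by (simp add: linear_scale[OF linF'[OF \<gamma>[OF q t]]])
      then have "((\<lambda>t. t *\<^sub>R F (\<gamma> q t)) has_derivative
          (\<lambda>s. t *\<^sub>R s *\<^sub>R F' (\<gamma> q t) (q - p) + s *\<^sub>R F (\<gamma> q t))) (at t)"
        by (auto intro!: derivative_eq_intros)
      then show ?thesis
        unfolding has_vector_derivative_def w_def
        by (rule has_derivative_at_withinI[THEN has_derivative_eq_rhs])
           (simp add: fun_eq_iff scaleR_add_right mult.commute)
    qed
    \<comment> \<open>The factor \<open>t\<close> kills the boundary term at 0, and
      \<open>\<gamma> q 1 = q\<close>, so the integral is \<open>F q\<close>.\<close>
    from fundamental_theorem_of_calculus[OF _ this] show ?thesis
      by (simp add: \<gamma>_def)
  qed
  define f where "f q = integral (cbox 0 1) (\<lambda>t. F (\<gamma> q t) \<bullet> (q - p))" for q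
  have "(f has_derivative (\<lambda>v. F q \<bullet> v)) (at q)" if q: "q \<in> B" for q
  proof -
    have "(f has_derivative integral (cbox 0 1) (\<lambda>t. blinfun_inner_right (w q t))) (at q within B)"
      unfolding f_def
    proof (rule leibniz_rule[OF _ _ _ q B(2)])
      fix q t assume q: "q \<in> B" and "t \<in> cbox 0 (1::real)"
      then have t: "t \<in> {0..1}" by simp
      have "((\<lambda>q. \<gamma> q t) has_derivative (\<lambda>v. t *\<^sub>R v)) (at q)"
        unfolding \<gamma>_def by (auto intro!: derivative_eq_intros)
      from has_derivative_compose[OF this F'[OF \<gamma>[OF q t]]]
      have "((\<lambda>q. F (\<gamma> q t)) has_derivative (\<lambda>v. t *\<^sub>R F' (\<gamma> q t) v)) (at q)"
        by (simp add: linear_scale[OF linF'[OF \<gamma>[OF q t]]])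
      then have "((\<lambda>q. F (\<gamma> q t) \<bullet> (q - p)) has_derivative
          (\<lambda>v. F (\<gamma> q t) \<bullet> v + t *\<^sub>R F' (\<gamma> q t) v \<bullet> (q - p))) (at q)"
        by (auto intro!: derivative_eq_intros)
      moreover have "F' (\<gamma> q t) v \<bullet> (q - p) = F' (\<gamma> q t) (q - p) \<bullet> v" for v
        unfolding F'_def by (rule sym[OF \<gamma>[OF q t]])
      ultimately show "((\<lambda>q. F (\<gamma> q t) \<bullet> (q - p)) has_derivative
          blinfun_apply (blinfun_inner_right (w q t))) (at q within B)"
        by (auto intro!: has_derivative_at_withinI elim!: has_derivative_eq_rhs
            simp: w_def inner_add_left inner_scaleR_left fun_eq_iff)
    next
      fix q assume q: "q \<in> B"
      have "continuous_on {0..1} (\<gamma> q)"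
        unfolding \<gamma>_def by (intro continuous_intros)
      then have "continuous_on {0..1} (\<lambda>t. F (\<gamma> q t) \<bullet> (q - p))"
        using \<gamma>[OF q] by (intro continuous_intros continuous_on_compose2[OF contF]) auto
      then show "(\<lambda>t. F (\<gamma> q t) \<bullet> (q - p)) integrable_on cbox 0 1"
        by (simp add: integrable_continuous_real)
    next
      show "continuous_on (B \<times> cbox 0 1) (\<lambda>(q, t). blinfun_inner_right (w q t))"
        using bounded_linear.continuous_on[OF bounded_linear_blinfun_inner_right contw]
        by (simp add: case_prod_beta)
    qed
    moreover have "integral (cbox 0 1) (\<lambda>t. blinfun_inner_right (w q t)) = blinfun_inner_right (F q)"
      using has_integral_linear[OF intw[OF q] bounded_linear_blinfun_inner_right]
      by (simp add: o_def integral_unique)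
    ultimately show ?thesis
      using at_within_open[OF q B(1)] by simp
  qed
  then show thesis by (rule that)
qed (rule that, blast)

section \<open>First-order systems along a frame of the plane\<close>

lemma linear_plane:
  fixes L :: "real \<times> real \<Rightarrow> 'b::real_vector"
  assumes "linear L"
  shows "L w = fst w *\<^sub>R L (1, 0) + snd w *\<^sub>R L (0, 1)"
proof -
  have "w = fst w *\<^sub>R (1, 0) + snd w *\<^sub>R (0, 1)" by (simp add: prod_eq_iff)
  then have "L w = L (fst w *\<^sub>R (1, 0) + snd w *\<^sub>R (0, 1))" by (rule arg_cong)
  also have "\<dots> = fst w *\<^sub>R L (1, 0) + snd w *\<^sub>R L (0, 1)"
    unfolding linear_add[OF assms] linear_scale[OF assms] ..
  finally show ?thesis .
qed

text \<open>In the plane the antisymmetric part of a bilinear form is a multiple of the determinant.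
  If it vanishes on one linearly independent pair, it therefore vanishes everywhere.\<close>

lemma symmetric_from_frame:
  fixes L :: "real \<times> real \<Rightarrow> real \<times> real"
  assumes "linear L" "det2 v w \<noteq> 0" "L v \<bullet> w = L w \<bullet> v"
  shows "L a \<bullet> b = L b \<bullet> a"
proof -
  have *: "L a \<bullet> b - L b \<bullet> a = det2 a b * (L (1, 0) \<bullet> (0, 1) - L (0, 1) \<bullet> (1, 0))" for a b
    unfolding linear_plane[OF assms(1), of a] linear_plane[OF assms(1), of b]
    by (cases a; cases b) (simp add: det2_def inner_prod_def algebra_simps)
  have "L (1, 0) \<bullet> (0, 1) - L (0, 1) \<bullet> (1, 0) = 0"
    using *[of v w] assms(2,3) by simp
  then show ?thesis using *[of a b] by simp
qed

text \<open>The hypothesis \<open>closed\<close> says that \<open>d\<omega>(V, P) = 0\<close> for the form \<open>\<omega>\<close> with \<open>\<omega>(V) = a\<close> and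
  \<open>\<omega>(P) = b\<close>.\<close>

lemma frame_system_solvable:
  fixes V P :: "real \<times> real \<Rightarrow> real \<times> real" and a b :: "real \<times> real \<Rightarrow> real"
  assumes B: "open B" "convex B"
    and V: "smooth_on B V" and P: "smooth_on B P"
    and a: "smooth_on B a" and b: "smooth_on B b"
    and frame: "\<And>q. q \<in> B \<Longrightarrow> det2 (V q) (P q) \<noteq> 0"
    and bracket: "\<And>q. q \<in> B \<Longrightarrow> lie_derivative V P q = l q *\<^sub>R P q + m q *\<^sub>R V q"
    and closed: "\<And>q. q \<in> B \<Longrightarrow> deriv_along V b q - deriv_along P a q = l q * b q + m q * a q"
  shows "\<exists>f. smooth_on B f \<and> (\<forall>q\<in>B. deriv_along V f q = a q \<and> deriv_along P f q = b q)"
proof -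
  \<comment> \<open>Cramer's rule for the covector with values \<open>a\<close> on \<open>V\<close>
    and \<open>b\<close> on \<open>P\<close>, written as a vector through the inner product.\<close>
  define F where "F q = (1 / det2 (V q) (P q)) *\<^sub>R
    (a q * snd (P q) - b q * snd (V q), b q * fst (V q) - a q * fst (P q))" for q
  have "smooth_on B (\<lambda>q. det2 (V q) (P q))"
    unfolding det2_def by (intro smooth_on_intros B V P)
  then have F: "smooth_on B F"
    unfolding F_def by (intro smooth_on_intros B V P a b) (use frame in auto)
  have FV: "F q \<bullet> V q = a q" and FP: "F q \<bullet> P q = b q" if "q \<in> B" for q
  proof -
    have "F q \<bullet> V q = (1 / det2 (V q) (P q)) * (a q * det2 (V q) (P q))"
      "F q \<bullet> P q = (1 / det2 (V q) (P q)) * (b q * det2 (V q) (P q))"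
      unfolding F_def inner_scaleR_left
      by (rule arg_cong[where f = "(*) _"], simp add: inner_prod_def det2_def algebra_simps)+
    then show "F q \<bullet> V q = a q" "F q \<bullet> P q = b q" using frame[OF that] by simp_all
  qed
  have sym: "frechet_derivative F (at q) u \<bullet> v = frechet_derivative F (at q) v \<bullet> u"
    if q: "q \<in> B" for q u v
  proof -
    \<comment> \<open>The identity \<open>F r \<bullet> Y r = c r\<close> differentiated along
      \<open>X\<close>; it is used for the pairs \<open>(P, b)\<close> and
      \<open>(V, a)\<close>.\<close>
    have prod: "deriv_along X c q = frechet_derivative F (at q) (X q) \<bullet> Y q + F q \<bullet> deriv_along X Y q"
      if "smooth_on B Y" "\<And>r. r \<in> B \<Longrightarrow> F r \<bullet> Y r = c r" for X Y c
    proof -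
      have "((\<lambda>r. F r \<bullet> Y r) has_derivative (\<lambda>h. F q \<bullet> frechet_derivative Y (at q) h +
          frechet_derivative F (at q) h \<bullet> Y q)) (at q)"
        by (intro has_derivative_inner smooth_on_has_derivative[OF F q] smooth_on_has_derivative[OF that(1) q])
      then have "(c has_derivative (\<lambda>h. F q \<bullet> frechet_derivative Y (at q) h +
          frechet_derivative F (at q) h \<bullet> Y q)) (at q)"
        by (rule has_derivative_transform_within_open[OF _ B(1) q that(2)])
      from frechet_derivative_at[OF this, symmetric] show ?thesis
        by (simp add: deriv_along_def)
    qed
    have "F q \<bullet> lie_derivative V P q = l q * b q + m q * a q"
      using q by (simp add: bracket inner_add_right FV FP)
    moreover have "deriv_along V b q = frechet_derivative F (at q) (V q) \<bullet> P q + F q \<bullet> deriv_along V P q"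
      by (rule prod[OF P FP])
    moreover have "deriv_along P a q = frechet_derivative F (at q) (P q) \<bullet> V q + F q \<bullet> deriv_along P V q"
      by (rule prod[OF V FV])
    \<comment> \<open>In the difference of the two product rules, the derivatives of the frame
      combine to \<open>F q \<bullet> lie_derivative V P q\<close>. The hypothesis
      \<open>closed\<close> cancels exactly this term, leaving symmetry of the derivative of
      \<open>F\<close> on the frame.\<close>
    ultimately have "frechet_derivative F (at q) (V q) \<bullet> P q = frechet_derivative F (at q) (P q) \<bullet> V q"
      using closed[OF q] by (simp add: lie_derivative_def inner_diff_right)
    then show ?thesis
      using symmetric_from_frame[OF has_derivative_linear[OF smooth_on_has_derivative[OF F q]]
          frame[OF q]] by blast
  qed
  have "Ck_on 1 B F" using F by (simp only: smooth_on_def)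
  then obtain f where f: "\<And>q. q \<in> B \<Longrightarrow> (f has_derivative (\<lambda>v. F q \<bullet> v)) (at q)"
    using closed_gradient_has_primitive[OF B _ sym] by metis
  have deriv: "deriv_along X f q = F q \<bullet> X q" if "q \<in> B" for X q
    using frechet_derivative_at[OF f[OF that], symmetric] by (simp add: deriv_along_def)
  have "smooth_on B f"
    by (rule smooth_on_has_derivativeI[OF B(1) f])
       (auto intro: smooth_on_bounded_linear[OF bounded_linear_inner_left] B F)
  then show ?thesis using deriv FV FP by auto
qed

text \<open>The inverse function theorem gives a local homeomorphism. Smoothness of the inverse is a
  bootstrap: its derivative at \<open>w\<close> is \<open>G\<close> taken at the inverse image of
  \<open>w\<close>, so order \<open>k\<close> for the inverse yields order \<open>Suc k\<close>.
  Having \<open>G\<close> explicit makes its smooth dependence on the point easy to check.\<close>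

lemma local_diffeomorphism:
  fixes f :: "'a::euclidean_space \<Rightarrow> 'a"
  assumes S: "open S" "x \<in> S" and f: "smooth_on S f"
    and G: "\<And>v. smooth_on S (\<lambda>q. G q v)"
    and inv: "\<And>q v. q \<in> S \<Longrightarrow> frechet_derivative f (at q) (G q v) = v"
  obtains U where "open U" "U \<subseteq> S" "x \<in> U" "diffeomorphism_onto_image U f"
    "\<And>q. q \<in> U \<Longrightarrow> (inv_into U f has_derivative G q) (at (f q))"
proof -
  define f' where "f' q = frechet_derivative f (at q)" for q
  have f': "(f has_derivative f' q) (at q)" if "q \<in> S" for q
    using smooth_on_has_derivative[OF f that] by (simp add: f'_def)
  have lin: "bounded_linear (f' q)" if "q \<in> S" for q
    using f'[OF that] by (rule has_derivative_bounded_linear)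
  have comp: "f' q \<circ> G q = id" if "q \<in> S" for q
    using inv[OF that] by (auto simp: f'_def)
  \<comment> \<open>Domain and codomain have the same finite dimension, so a right inverse of a
    linear map is linear and two-sided.\<close>
  have linG: "linear (G q)" and comp': "G q \<circ> f' q = id" if "q \<in> S" for q
    using right_inverse_linear[OF bounded_linear.linear[OF lin[OF that]] comp[OF that]]
      linear_inverse_left[OF bounded_linear.linear[OF lin[OF that]], of "G q"] comp[OF that] by auto
  have ap: "blinfun_apply (Blinfun (f' q)) = f' q" if "q \<in> S" for q
    using lin[OF that] by (rule bounded_linear_Blinfun_apply)
  have apG: "blinfun_apply (Blinfun (G x)) = G x"
    using linG[OF S(2)] by (intro bounded_linear_Blinfun_apply) (simp add: linear_conv_bounded_linear)
  obtain U W g where U: "open U" "U \<subseteq> S" "x \<in> U" "open W" and hom: "homeomorphism U W f g"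
  proof (rule inverse_function_theorem[OF S(1) _ _ S(2), of f "\<lambda>q. Blinfun (f' q)" "Blinfun (G x)"])
    show "(f has_derivative blinfun_apply (Blinfun (f' q))) (at q)" if "q \<in> S" for q
      using f' ap that by simp
    \<comment> \<open>In finite dimension, continuity of the derivative in each fixed direction
      implies continuity in operator norm.\<close>
    have "Ck_on (Suc 0) S f" using f by (simp only: smooth_on_def)
    then have "continuous_on S (\<lambda>q. f' q b)" for b by (simp add: f'_def[abs_def])
    then show "continuous_on S (\<lambda>q. Blinfun (f' q))"
      by (intro continuous_on_blinfun_componentwise) (simp add: ap cong: continuous_on_cong)
    show "Blinfun (G x) o\<^sub>L Blinfun (f' x) = id_blinfun"
      using comp'[OF S(2)] by (intro blinfun_eqI) (simp add: ap[OF S(2)] apG pointfree_idE)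
  qed blast
  have img: "f ` U = W" and inj: "inj_on f U"
    using hom by (auto simp: homeomorphism_def inj_on_def) (metis+)
  have der: "(inv_into U f has_derivative G q) (at (f q))" if "q \<in> U" for q
    using U inj that by (intro has_derivative_inverse_on[OF U(1) f' _ comp]) auto
  have "smooth_on W (inv_into U f)"
    unfolding smooth_on_def
  proof
    show "Ck_on k W (inv_into U f)" for k
    proof (induction k)
      case 0
      have "continuous_on W (inv_into U f)"
        using der img U(4) by (auto simp: continuous_on_eq_continuous_at intro: has_derivative_continuous)
      then show ?case by simp
    next
      case (Suc k)
      show ?case
      proof (rule Ck_on_SucI[OF U(4)])
        show "(inv_into U f has_derivative G (inv_into U f w)) (at w)" if "w \<in> W" for w
          using that der inj by (auto simp flip: img)
        show "Ck_on k W (\<lambda>w. G (inv_into U f w) v)" for v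
        proof (rule Ck_on_compose[OF U(4) _ Suc])
          show "Ck_on k U (\<lambda>q. G q v)" using smooth_on_subset[OF G[of v] U(2)] by (simp add: smooth_on_def)
          show "inv_into U f ` W \<subseteq> U" by (auto simp flip: img intro: inv_into_into)
        qed
      qed
    qed
  qed
  then have "diffeomorphism_onto_image U f"
    using U(4) inj smooth_on_subset[OF f U(2)] by (simp add: diffeomorphism_onto_image_def img)
  then show thesis using that U der by blast
qed

subsection \<open>Derivatives along vector fields\<close>

lemma deriv_along_eq: "(f has_derivative f') (at q) \<Longrightarrow> deriv_along X f q = f' (X q)"
  using frechet_derivative_at[of f f' q] by (simp add: deriv_along_def)

lemma deriv_along_mult:
  fixes f g :: "'a::real_normed_vector \<Rightarrow> real"
  assumes "f differentiable (at q)" "g differentiable (at q)"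
  shows "deriv_along X (\<lambda>r. f r * g r) q = deriv_along X f q * g q + f q * deriv_along X g q"
  using deriv_along_eq[OF has_derivative_mult[OF assms[unfolded frechet_derivative_works]], of X]
  by (simp add: deriv_along_def)

lemma deriv_along_divide:
  fixes f g :: "'a::real_normed_vector \<Rightarrow> real"
  assumes "f differentiable (at q)" "g differentiable (at q)" "g q \<noteq> 0"
  shows "deriv_along X (\<lambda>r. f r / g r) q =
    (deriv_along X f q * g q - f q * deriv_along X g q) / (g q)\<^sup>2"
  using deriv_along_eq[OF has_derivative_divide'[OF assms(1,2)[unfolded frechet_derivative_works] assms(3)], of X]
  by (simp add: deriv_along_def power2_eq_square)

lemma deriv_along_add:
  assumes "f differentiable (at q)" "g differentiable (at q)"
  shows "deriv_along X (\<lambda>r. f r + g r) q = deriv_along X f q + deriv_along X g q"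
  using deriv_along_eq[OF has_derivative_add[OF assms[unfolded frechet_derivative_works]], of X]
  by (simp add: deriv_along_def)

lemma deriv_along_diff:
  assumes "f differentiable (at q)" "g differentiable (at q)"
  shows "deriv_along X (\<lambda>r. f r - g r) q = deriv_along X f q - deriv_along X g q"
  using deriv_along_eq[OF has_derivative_diff[OF assms[unfolded frechet_derivative_works]], of X]
  by (simp add: deriv_along_def)

lemma deriv_along_minus:
  assumes "f differentiable (at q)"
  shows "deriv_along X (\<lambda>r. - f r) q = - deriv_along X f q"
  using deriv_along_eq[OF has_derivative_minus[OF assms[unfolded frechet_derivative_works]], of X]
  by (simp add: deriv_along_def)

lemma deriv_along_const: "deriv_along X (\<lambda>r. c) q = 0"
  by (simp add: deriv_along_def)

lemma deriv_along_Pair: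
  assumes "f differentiable (at q)" "g differentiable (at q)"
  shows "deriv_along X (\<lambda>r. (f r, g r)) q = (deriv_along X f q, deriv_along X g q)"
  using deriv_along_eq[OF has_derivative_Pair[OF assms[unfolded frechet_derivative_works]], of X]
  by (simp add: deriv_along_def)

lemma deriv_along_sin:
  assumes "f differentiable (at q)"
  shows "deriv_along X (\<lambda>r. sin (f r :: real)) q = cos (f q) * deriv_along X f q"
  using deriv_along_eq[OF has_derivative_sin[OF assms[unfolded frechet_derivative_works]], of X]
  by (simp add: deriv_along_def)

lemma deriv_along_cos:
  assumes "f differentiable (at q)"
  shows "deriv_along X (\<lambda>r. cos (f r :: real)) q = - sin (f q) * deriv_along X f q"
  using deriv_along_eq[OF has_derivative_cos[OF assms[unfolded frechet_derivative_works]], of X]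
  by (simp add: deriv_along_def)

lemmas deriv_along_simps = deriv_along_mult deriv_along_divide deriv_along_add deriv_along_diff
  deriv_along_minus deriv_along_const deriv_along_sin deriv_along_cos

section \<open>Determinants and orthonormal frames in the plane\<close>

lemma det2_linear:
  assumes "linear L"
  shows "det2 (L v) (L w) = det2 (L (1, 0)) (L (0, 1)) * det2 v w"
  unfolding linear_plane[OF assms, of v] linear_plane[OF assms, of w]
  by (simp add: det2_def algebra_simps)

text \<open>The vectors \<open>(s, -c)\<close> and \<open>(c, s)\<close> are orthonormal, and the
  coefficients are the inner products of \<open>v\<close> with them.\<close>

lemma rotated_coordinates:
  fixes s c :: real
  assumes "s\<^sup>2 + c\<^sup>2 = 1"
  shows "(fst v * s - snd v * c) *\<^sub>R (s, - c) + (fst v * c + snd v * s) *\<^sub>R (c, s) = v"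
proof -
  have "a * (s * s) + a * (c * c) = a" for a
    using assms by (metis distrib_left mult.right_neutral power2_eq_square)
  then show ?thesis by (cases v) (simp add: algebra_simps)
qed

subsection \<open>The coordinates\<close>

text \<open>Four systems along the frame are solved in succession on a convex set. The right-hand
  sides for \<open>x\<close>, \<open>y\<close> and \<open>z\<close> involve functions found earlier,
  whose known derivatives along \<open>V\<close> and \<open>P\<close> verify closedness.\<close>

lemma angle_coordinates_contact_height:
  fixes V P :: "real \<times> real \<Rightarrow> real \<times> real" and D H :: "real \<times> real \<Rightarrow> real"
  assumes B: "open B" "convex B"
    and V: "smooth_on B V" and P: "smooth_on B P"
    and D: "smooth_on B D" "\<And>q. q \<in> B \<Longrightarrow> D q > 0" and H: "smooth_on B H"
    and frame: "\<And>q. q \<in> B \<Longrightarrow> det2 (V q) (P q) \<noteq> 0"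
    and D_eq: "\<And>q. q \<in> B \<Longrightarrow> D q * deriv_along V (deriv_along V D) q =
        2 * (deriv_along V D q - 1) * (deriv_along V D q - 2) +
        ((H q)\<^sup>2 + deriv_along P H q) * (D q)\<^sup>2"
    and Lie_eq: "\<And>q. q \<in> B \<Longrightarrow> lie_derivative V P q =
        - ((2 - deriv_along V D q) / D q) *\<^sub>R P q + H q *\<^sub>R V q"
  shows "\<exists>\<theta> x y z. smooth_on B \<theta> \<and> smooth_on B x \<and> smooth_on B y \<and> smooth_on B z \<and>
    (\<forall>q\<in>B. deriv_along V \<theta> q = - H q \<and> deriv_along P \<theta> q = (2 - deriv_along V D q) / D q \<and>
      deriv_along V x q = sin (\<theta> q) \<and> deriv_along P x q = cos (\<theta> q) \<and>
      deriv_along V y q = - cos (\<theta> q) \<and> deriv_along P y q = sin (\<theta> q) \<and>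
      deriv_along V z q = y q * sin (\<theta> q) + x q * cos (\<theta> q) \<and>
      deriv_along P z q = D q + y q * cos (\<theta> q) - x q * sin (\<theta> q))"
proof -
  define g where "g q = (2 - deriv_along V D q) / D q" for q
  have VD: "smooth_on B (deriv_along V D)"
    by (intro smooth_on_deriv_along B V D)
  have g: "smooth_on B g"
    unfolding g_def by (intro smooth_on_intros B VD D) (use D(2) in force)
  have bracket: "lie_derivative V P q = (- g q) *\<^sub>R P q + H q *\<^sub>R V q" if "q \<in> B" for q
    using Lie_eq[OF that] by (simp add: g_def)
  note solve = frame_system_solvable[OF B V P _ _ frame bracket]
  note diff = smooth_on_differentiable
  \<comment> \<open>The second-order equation for \<open>D\<close> is a Riccati equation for \<open>g\<close>; it is exactly the
    integrability condition for \<open>\<theta>\<close>.\<close>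
  have Vg: "deriv_along V g q + deriv_along P H q = - (g q)\<^sup>2 - (H q)\<^sup>2" if q: "q \<in> B" for q
  proof -
    have "deriv_along V g q = (- (D q * deriv_along V (deriv_along V D) q)
        - (2 - deriv_along V D q) * deriv_along V D q) / (D q)\<^sup>2"
      unfolding g_def[abs_def] using D(2)[OF q] diff[OF VD q] diff[OF D(1) q]
      by (simp add: deriv_along_simps mult.commute)
    \<comment> \<open>With \<open>D'\<close> for \<open>deriv_along V D q\<close>, the constants
      combine as -2(D'-1)(D'-2) - (2-D')D' = -(2-D')^2, which is why a perfect square
      appears.\<close>
    also have "\<dots> = - ((2 - deriv_along V D q)\<^sup>2 / (D q)\<^sup>2) - (H q)\<^sup>2 - deriv_along P H q"
      unfolding D_eq[OF q] using D(2)[OF q] by (simp add: field_simps power2_eq_square)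
    finally show ?thesis by (simp add: g_def power_divide)
  qed
  have "\<exists>\<theta>. smooth_on B \<theta> \<and> (\<forall>q\<in>B. deriv_along V \<theta> q = - H q \<and> deriv_along P \<theta> q = g q)"
  proof (rule solve)
    show "deriv_along V g q - deriv_along P (\<lambda>q. - H q) q = - g q * g q + H q * - H q"
      if "q \<in> B" for q
      using Vg[OF that] diff[OF H that] by (simp add: deriv_along_minus power2_eq_square)
  qed (intro smooth_on_uminus B H g)+
  then obtain \<theta> where \<theta>: "smooth_on B \<theta>" "\<And>q. q \<in> B \<Longrightarrow> deriv_along V \<theta> q = - H q"
    "\<And>q. q \<in> B \<Longrightarrow> deriv_along P \<theta> q = g q" by blast
  have sin: "smooth_on B (\<lambda>q. sin (\<theta> q))" and cos: "smooth_on B (\<lambda>q. cos (\<theta> q))"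
    by (intro smooth_on_intros B \<theta>(1))+
  have "\<exists>x. smooth_on B x \<and> (\<forall>q\<in>B. deriv_along V x q = sin (\<theta> q) \<and> deriv_along P x q = cos (\<theta> q))"
  proof (rule solve[OF sin cos])
    show "deriv_along V (\<lambda>q. cos (\<theta> q)) q - deriv_along P (\<lambda>q. sin (\<theta> q)) q =
        - g q * cos (\<theta> q) + H q * sin (\<theta> q)" if "q \<in> B" for q
      using that diff[OF \<theta>(1) that] by (simp add: deriv_along_simps \<theta>)
  qed
  then obtain x where x: "smooth_on B x" "\<And>q. q \<in> B \<Longrightarrow> deriv_along V x q = sin (\<theta> q)"
    "\<And>q. q \<in> B \<Longrightarrow> deriv_along P x q = cos (\<theta> q)" by blast
  have "\<exists>y. smooth_on B y \<and> (\<forall>q\<in>B. deriv_along V y q = - cos (\<theta> q) \<and> deriv_along P y q = sin (\<theta> q))"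
  proof (rule solve[OF smooth_on_uminus[OF B(1) cos] sin])
    show "deriv_along V (\<lambda>q. sin (\<theta> q)) q - deriv_along P (\<lambda>q. - cos (\<theta> q)) q =
        - g q * sin (\<theta> q) + H q * - cos (\<theta> q)" if "q \<in> B" for q
      using that diff[OF \<theta>(1) that] diff[OF cos that] by (simp add: deriv_along_simps \<theta>)
  qed
  then obtain y where y: "smooth_on B y" "\<And>q. q \<in> B \<Longrightarrow> deriv_along V y q = - cos (\<theta> q)"
    "\<And>q. q \<in> B \<Longrightarrow> deriv_along P y q = sin (\<theta> q)" by blast
  \<comment> \<open>These values of \<open>V z\<close> and \<open>P z\<close> express \<open>dz + x dy - y dx = D (cos \<theta> dx + sin \<theta> dy)\<close>.\<close>
  let ?a = "\<lambda>q. y q * sin (\<theta> q) + x q * cos (\<theta> q)"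
  let ?b = "\<lambda>q. D q + y q * cos (\<theta> q) - x q * sin (\<theta> q)"
  have "\<exists>z. smooth_on B z \<and> (\<forall>q\<in>B. deriv_along V z q = ?a q \<and> deriv_along P z q = ?b q)"
  proof (rule solve)
    show "smooth_on B ?a" "smooth_on B ?b"
      by (intro smooth_on_intros B x(1) y(1) D(1) \<theta>(1))+
    show "deriv_along V ?b q - deriv_along P ?a q = - g q * ?b q + H q * ?a q" if q: "q \<in> B" for q
    proof -
      \<comment> \<open>The derivatives of \<open>x\<close> and \<open>y\<close> contribute -2,
        reflecting d(x dy - y dx) = 2 dx dy on the oriented orthonormal frame. It is cancelled by
        the 2 in \<open>g q * D q = 2 - deriv_along V D q\<close>.\<close>
      have "deriv_along V ?b q - deriv_along P ?a q = deriv_along V D q -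
          2 * ((sin (\<theta> q))\<^sup>2 + (cos (\<theta> q))\<^sup>2)
          - g q * (y q * cos (\<theta> q) - x q * sin (\<theta> q)) + H q * ?a q"
        unfolding power2_eq_square
        using q diff[OF \<theta>(1) q] diff[OF sin q] diff[OF cos q] diff[OF x(1) q] diff[OF y(1) q] diff[OF D(1) q]
        by (simp add: deriv_along_simps \<theta> x y algebra_simps)
      moreover have "g q * D q = 2 - deriv_along V D q"
        using D(2)[OF q] by (simp add: g_def)
      ultimately show ?thesis by (simp add: algebra_simps)
    qed
  qed
  then obtain z where z: "smooth_on B z" "\<And>q. q \<in> B \<Longrightarrow> deriv_along V z q = ?a q"
    "\<And>q. q \<in> B \<Longrightarrow> deriv_along P z q = ?b q" by blast
  show ?thesis
    by (rule exI[of _ \<theta>], rule exI[of _ x], rule exI[of _ y], rule exI[of _ z])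
       (simp add: \<theta> x y z flip: g_def)
qed

text \<open>Here \<open>\<phi>\<close> sends \<open>V\<close> and \<open>P\<close> at \<open>q\<close> to \<open>(s, -c)\<close> and \<open>(c, s)\<close>.\<close>

lemma partial_derivatives_via_frame:
  fixes k h :: "real \<times> real \<Rightarrow> real"
  assumes U: "open (\<phi> ` U)" "inj_on \<phi> U" and q: "q \<in> U" and h: "h differentiable (at q)"
    and inv: "(inv_into U \<phi> has_derivative
      (\<lambda>v. (fst v * s - snd v * c) *\<^sub>R V q + (fst v * c + snd v * s) *\<^sub>R P q)) (at (\<phi> q))"
    and k: "\<And>r. r \<in> U \<Longrightarrow> k (\<phi> r) = h r"
  shows "partial_x k (\<phi> q) = s * deriv_along V h q + c * deriv_along P h q"
    and "partial_y k (\<phi> q) = s * deriv_along P h q - c * deriv_along V h q"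
proof -
  let ?G = "\<lambda>v. (fst v * s - snd v * c) *\<^sub>R V q + (fst v * c + snd v * s) *\<^sub>R P q"
  have \<psi>: "inv_into U \<phi> (\<phi> r) = r" if "r \<in> U" for r
    using U(2) that by simp
  have h': "(h has_derivative frechet_derivative h (at q)) (at (inv_into U \<phi> (\<phi> q)))"
    using h \<psi>[OF q] by (simp add: frechet_derivative_works)
  have "((\<lambda>w. h (inv_into U \<phi> w)) has_derivative (\<lambda>v. frechet_derivative h (at q) (?G v))) (at (\<phi> q))"
    by (rule has_derivative_compose[OF inv h'])
  \<comment> \<open>\<open>k\<close> is known to be \<open>h\<close> composed with the inverse of
    \<open>\<phi>\<close> only on the image of \<open>U\<close>; as the image is open, this
    determines the derivative.\<close>
  then have "(k has_derivative (\<lambda>v. frechet_derivative h (at q) (?G v))) (at (\<phi> q))"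
    by (rule has_derivative_transform_within_open[OF _ U(1)]) (use q k \<psi> in auto)
  from frechet_derivative_at[OF this, symmetric]
  have *: "frechet_derivative k (at (\<phi> q)) v = frechet_derivative h (at q) (?G v)" for v
    by simp
  have "frechet_derivative k (at (\<phi> q)) v =
      (fst v * s - snd v * c) * deriv_along V h q + (fst v * c + snd v * s) * deriv_along P h q" for v
    unfolding * deriv_along_def
    using linear_frechet_derivative[OF h] by (simp add: linear_add linear_scale)
  then show "partial_x k (\<phi> q) = s * deriv_along V h q + c * deriv_along P h q"
    "partial_y k (\<phi> q) = s * deriv_along P h q - c * deriv_along V h q"
    by (simp_all add: partial_x_def partial_y_def)
qed

text \<open>The geometric content as pointwise identities. The two equations for
  \<open>partial_x u\<close> and \<open>partial_y u\<close> say that the horizontal gradient of the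
  graph has length \<open>D\<close> and direction \<open>(cos \<theta>, sin \<theta>)\<close>; the
  formulas for \<open>D\<close> and \<open>N\<close> are read off from them.\<close>

lemma heisenberg_graph_coordinates:
  fixes V P :: "real \<times> real \<Rightarrow> real \<times> real"
    and D H :: "real \<times> real \<Rightarrow> real"
    and U :: "(real \<times> real) set"
    and p :: "real \<times> real"
  assumes U: "open U" "p \<in> U"
    and V: "smooth_on U V" and D: "smooth_on U D" "\<forall>q\<in>U. D q > 0"
    and H: "smooth_on U H" and P: "smooth_on U P"
    and orientation: "\<forall>q\<in>U. same_orientation (V q, P q) ((1, 0), (0, 1))"
    and D_eq: "\<forall>q\<in>U. D q * deriv_along V (deriv_along V D) q =
        2 * (deriv_along V D q - 1) * (deriv_along V D q - 2) +
        ((H q)\<^sup>2 + deriv_along P H q) * (D q)\<^sup>2"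
    and Lie_eq: "\<forall>q\<in>U. lie_derivative V P q =
        - ((2 - deriv_along V D q) / D q) *\<^sub>R P q + H q *\<^sub>R V q"
  obtains U' x y \<theta> \<phi> z u where "U' \<subseteq> U" "open U'" "p \<in> U'" "\<phi> = (\<lambda>q. (x q, y q))"
    and "diffeomorphism_onto_image U' \<phi>" "orientation_preserving_on U' \<phi>"
    and "smooth_on U' \<theta>" "smooth_on U' z" "smooth_on (\<phi> ` U') u"
    and "smooth_embedding_on U' (\<lambda>q. (x q, y q, z q) :: heisenberg)"
    and "\<And>q. q \<in> U' \<Longrightarrow> deriv_along V \<theta> q = - H q"
    and "\<And>q. q \<in> U' \<Longrightarrow> deriv_along P \<theta> q = (2 - deriv_along V D q) / D q"
    and "\<And>q. q \<in> U' \<Longrightarrow> deriv_along V x q = sin (\<theta> q)"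
    and "\<And>q. q \<in> U' \<Longrightarrow> deriv_along P x q = cos (\<theta> q)"
    and "\<And>q. q \<in> U' \<Longrightarrow> deriv_along V y q = - cos (\<theta> q)"
    and "\<And>q. q \<in> U' \<Longrightarrow> deriv_along P y q = sin (\<theta> q)"
    and "\<And>M q. q \<in> U' \<Longrightarrow> deriv_along M x q = cos (\<theta> q) \<Longrightarrow> deriv_along M y q = sin (\<theta> q) \<Longrightarrow> M q = P q"
    and "\<And>q. q \<in> U' \<Longrightarrow> u (x q, y q) = z q"
    and "\<And>q. q \<in> U' \<Longrightarrow> partial_x u (\<phi> q) - y q = D q * cos (\<theta> q)"
    and "\<And>q. q \<in> U' \<Longrightarrow> partial_y u (\<phi> q) + x q = D q * sin (\<theta> q)"
    and "\<And>q. q \<in> U' \<Longrightarrow> pushforward U' \<phi> P (\<phi> q) = (cos (\<theta> q), sin (\<theta> q))"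
    and "\<And>q. q \<in> U' \<Longrightarrow> divergence (pushforward U' \<phi> P) (\<phi> q) = H q"
    and "\<And>q. q \<in> U' \<Longrightarrow> divergence (pushforward U' \<phi> (\<lambda>r. D r *\<^sub>R V r)) (\<phi> q) = 2"
proof -
  obtain \<epsilon> where \<epsilon>: "\<epsilon> > 0" "ball p \<epsilon> \<subseteq> U"
    using U open_contains_ball by blast
  \<comment> \<open>A ball supplies the convexity needed for the primitives.\<close>
  define B where "B = ball p \<epsilon>"
  have B: "open B" "convex B" "p \<in> B" "B \<subseteq> U"
    using \<epsilon> by (auto simp: B_def)
  have frame: "det2 (V q) (P q) > 0" if "q \<in> U" for q
    using orientation that by (simp add: same_orientation_def det2_def)
  have "\<exists>\<theta> x y z. smooth_on B \<theta> \<and> smooth_on B x \<and> smooth_on B y \<and> smooth_on B z \<and>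
    (\<forall>q\<in>B. deriv_along V \<theta> q = - H q \<and> deriv_along P \<theta> q = (2 - deriv_along V D q) / D q \<and>
      deriv_along V x q = sin (\<theta> q) \<and> deriv_along P x q = cos (\<theta> q) \<and>
      deriv_along V y q = - cos (\<theta> q) \<and> deriv_along P y q = sin (\<theta> q) \<and>
      deriv_along V z q = y q * sin (\<theta> q) + x q * cos (\<theta> q) \<and>
      deriv_along P z q = D q + y q * cos (\<theta> q) - x q * sin (\<theta> q))"
  proof (rule angle_coordinates_contact_height[OF B(1,2)])
    show "smooth_on B V" "smooth_on B P" "smooth_on B D" "smooth_on B H"
      using smooth_on_subset[OF _ B(4)] V P D H by blast+
    show "det2 (V q) (P q) \<noteq> 0" "D q > 0" if "q \<in> B" for q
      using frame[of q] D(2) B(4) that by auto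
  qed (use D_eq Lie_eq B(4) in blast)+
  then obtain \<theta> x y z where smooth: "smooth_on B \<theta>" "smooth_on B x" "smooth_on B y" "smooth_on B z"
    and "\<forall>q\<in>B. deriv_along V \<theta> q = - H q \<and> deriv_along P \<theta> q = (2 - deriv_along V D q) / D q \<and>
      deriv_along V x q = sin (\<theta> q) \<and> deriv_along P x q = cos (\<theta> q) \<and>
      deriv_along V y q = - cos (\<theta> q) \<and> deriv_along P y q = sin (\<theta> q) \<and>
      deriv_along V z q = y q * sin (\<theta> q) + x q * cos (\<theta> q) \<and>
      deriv_along P z q = D q + y q * cos (\<theta> q) - x q * sin (\<theta> q)"
    by blast
  then have derivs: "\<And>q. q \<in> B \<Longrightarrow> deriv_along V \<theta> q = - H q"
    "\<And>q. q \<in> B \<Longrightarrow> deriv_along P \<theta> q = (2 - deriv_along V D q) / D q"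
    "\<And>q. q \<in> B \<Longrightarrow> deriv_along V x q = sin (\<theta> q)"
    "\<And>q. q \<in> B \<Longrightarrow> deriv_along P x q = cos (\<theta> q)"
    "\<And>q. q \<in> B \<Longrightarrow> deriv_along V y q = - cos (\<theta> q)"
    "\<And>q. q \<in> B \<Longrightarrow> deriv_along P y q = sin (\<theta> q)"
    "\<And>q. q \<in> B \<Longrightarrow> deriv_along V z q = y q * sin (\<theta> q) + x q * cos (\<theta> q)"
    "\<And>q. q \<in> B \<Longrightarrow> deriv_along P z q = D q + y q * cos (\<theta> q) - x q * sin (\<theta> q)"
    by blast+
  define \<phi> where "\<phi> = (\<lambda>q. (x q, y q))"
  \<comment> \<open>The inverse of the derivative of \<open>\<phi>\<close>: expand \<open>v\<close>
    in the orthonormal frame that is the image of \<open>V q\<close> and \<open>P q\<close>, and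
    replace the frame vectors by their preimages.\<close>
  define G where "G q v = (fst v * sin (\<theta> q) - snd v * cos (\<theta> q)) *\<^sub>R V q +
    (fst v * cos (\<theta> q) + snd v * sin (\<theta> q)) *\<^sub>R P q" for q and v :: "real \<times> real"
  have \<phi>: "smooth_on B \<phi>"
    unfolding \<phi>_def by (intro smooth_on_Pair B smooth)
  have along_\<phi>: "deriv_along X \<phi> q = (deriv_along X x q, deriv_along X y q)" if "q \<in> B" for X q
    unfolding \<phi>_def using smooth that by (intro deriv_along_Pair smooth_on_differentiable)
  have lin: "linear (frechet_derivative \<phi> (at q))" if "q \<in> B" for q
    using smooth_on_differentiable[OF \<phi> that] by (rule linear_frechet_derivative)
  have \<phi>V: "frechet_derivative \<phi> (at q) (V q) = (sin (\<theta> q), - cos (\<theta> q))"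
    and \<phi>P: "frechet_derivative \<phi> (at q) (P q) = (cos (\<theta> q), sin (\<theta> q))" if "q \<in> B" for q
    using along_\<phi>[OF that, of V] along_\<phi>[OF that, of P] derivs that
    by (simp_all add: deriv_along_def)
  have \<phi>G: "frechet_derivative \<phi> (at q) (G q v) = v" if "q \<in> B" for q v
    unfolding G_def linear_add[OF lin[OF that]] linear_scale[OF lin[OF that]] \<phi>V[OF that] \<phi>P[OF that]
    by (rule rotated_coordinates) simp
  have "smooth_on B (\<lambda>q. G q v)" for v
    unfolding G_def using smooth_on_subset[OF V(1) B(4)] smooth_on_subset[OF P(1) B(4)]
    by (intro smooth_on_intros B smooth)
  then obtain U' where U': "open U'" "U' \<subseteq> B" "p \<in> U'" and diffeo: "diffeomorphism_onto_image U' \<phi>"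
    and inv: "\<And>q. q \<in> U' \<Longrightarrow> (inv_into U' \<phi> has_derivative G q) (at (\<phi> q))"
    using local_diffeomorphism[OF B(1,3) \<phi> _ \<phi>G] by metis
  have inB: "q \<in> B" and inU: "q \<in> U" if "q \<in> U'" for q
    using that U'(2) B(4) by auto
  have img: "open (\<phi> ` U')" and inj: "inj_on \<phi> U'" and inv_smooth: "smooth_on (\<phi> ` U') (inv_into U' \<phi>)"
    using diffeo by (auto simp: diffeomorphism_onto_image_def)
  have inv_\<phi>: "inv_into U' \<phi> (\<phi> q) = q" if "q \<in> U'" for q
    using inj that by simp
  \<comment> \<open>By \<open>\<phi>G\<close> the derivative is onto, hence injective, as the
    dimensions agree.\<close>
  have inj': "inj (frechet_derivative \<phi> (at q))" if "q \<in> U'" for q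
    using \<phi>G[OF inB[OF that]] lin[OF inB[OF that]]
    by (metis linear_surjective_imp_injective surjI)
  note diff = smooth_on_differentiable[OF smooth(1) inB] smooth_on_differentiable[OF smooth(2) inB]
    smooth_on_differentiable[OF smooth(3) inB] smooth_on_differentiable[OF smooth(4) inB]
    smooth_on_differentiable[OF D(1) inU]
  have partials: "partial_x k (\<phi> q) = sin (\<theta> q) * deriv_along V h q + cos (\<theta> q) * deriv_along P h q"
    "partial_y k (\<phi> q) = sin (\<theta> q) * deriv_along P h q - cos (\<theta> q) * deriv_along V h q"
    if "q \<in> U'" "h differentiable (at q)" "\<And>r. r \<in> U' \<Longrightarrow> k (\<phi> r) = h r" for q k h
    using partial_derivatives_via_frame[where s = "sin (\<theta> q)" and c = "cos (\<theta> q)" and V = V and P = P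
        and k = k and h = h, OF img inj that(1,2) inv[OF that(1), unfolded G_def[abs_def]] that(3)]
    by simp_all
  have divergence: "divergence W (\<phi> q) = sin (\<theta> q) * deriv_along V h q + cos (\<theta> q) * deriv_along P h q +
      (sin (\<theta> q) * deriv_along P k q - cos (\<theta> q) * deriv_along V k q)"
    if "q \<in> U'" "h differentiable (at q)" "k differentiable (at q)"
      "\<And>r. r \<in> U' \<Longrightarrow> W (\<phi> r) = (h r, k r)" for q W h k
    using partials(1)[of q h "\<lambda>r. fst (W r)"] partials(2)[of q k "\<lambda>r. snd (W r)"] that
    by (simp add: divergence_def)
  have pythagoras: "sin a * (sin a * t) + cos a * (cos a * t) = t" for a t :: real
    using sin_cos_squared_add[of a] by (metis distrib_right mult.assoc mult_1 power2_eq_square)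
  have push: "pushforward U' \<phi> X (\<phi> q) = deriv_along X \<phi> q" if "q \<in> U'" for X q
    by (simp add: pushforward_def inv_\<phi>[OF that])
  define u where "u = (\<lambda>w. z (inv_into U' \<phi> w))"
  define F :: "real \<times> real \<Rightarrow> heisenberg" where "F = (\<lambda>q. (x q, y q, z q))"
  have u\<phi>: "u (\<phi> q) = z q" if "q \<in> U'" for q
    by (simp add: u_def inv_\<phi>[OF that])
  \<comment> \<open>For \<open>ux\<close>, in sin * V z + cos * P z the terms with \<open>x\<close>
    cancel, those with \<open>y\<close> add up to \<open>y q\<close>, and D cos remains. For
    \<open>uy\<close> the roles of \<open>x\<close> and \<open>y\<close> are exchanged and
    \<open>x q\<close> appears with a minus sign.\<close>
  have ux: "partial_x u (\<phi> q) - y q = D q * cos (\<theta> q)"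
    and uy: "partial_y u (\<phi> q) + x q = D q * sin (\<theta> q)" if q: "q \<in> U'" for q
    using partials[OF q diff(4)[OF q] u\<phi>] inB[OF q] pythagoras[of "\<theta> q" "y q"] pythagoras[of "\<theta> q" "x q"]
    by (simp_all add: derivs algebra_simps)
  have orient: "orientation_preserving_on U' \<phi>"
    unfolding orientation_preserving_on_def
  proof
    fix q assume q: "q \<in> U'"
    \<comment> \<open>The image frame has determinant 1. By \<open>det2_linear\<close> this is the
      Jacobian determinant of \<open>\<phi>\<close> times the positive number
      \<open>det2 (V q) (P q)\<close>.\<close>
    have "det2 (sin (\<theta> q), - cos (\<theta> q)) (cos (\<theta> q), sin (\<theta> q)) = 1"
      using pythagoras[of "\<theta> q" 1] by (simp add: det2_def)
    then have "det2 (frechet_derivative \<phi> (at q) (1, 0)) (frechet_derivative \<phi> (at q) (0, 1)) *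
        det2 (V q) (P q) = 1"
      using det2_linear[OF lin[OF inB[OF q]], of "V q" "P q"] \<phi>V \<phi>P inB[OF q] by simp
    then have "det2 (frechet_derivative \<phi> (at q) (1, 0)) (frechet_derivative \<phi> (at q) (0, 1)) > 0"
      using frame[OF inU[OF q]] by (metis zero_less_mult_pos2 zero_less_one)
    then show "same_orientation (frechet_derivative \<phi> (at q) (1, 0), frechet_derivative \<phi> (at q) (0, 1))
        ((1, 0), (0, 1))"
      by (simp add: same_orientation_def det2_def)
  qed
  have unique: "M q = P q" if "q \<in> U'" "deriv_along M x q = cos (\<theta> q)" "deriv_along M y q = sin (\<theta> q)"
    for M q
  proof -
    have "frechet_derivative \<phi> (at q) (M q) = frechet_derivative \<phi> (at q) (P q)"
      using that along_\<phi>[OF inB[OF that(1)], of M] \<phi>P[OF inB[OF that(1)]] by (simp add: deriv_along_def)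
    then show ?thesis using inj'[OF that(1)] by (simp add: inj_eq)
  qed
  have embedding: "smooth_embedding_on U' F"
    unfolding smooth_embedding_on_def
  proof (intro conjI ballI)
    have smooth_F: "smooth_on B F"
      unfolding F_def by (intro smooth_on_Pair B smooth)
    then show "smooth_on U' F" using U'(2) by (rule smooth_on_subset)
    show "inj (frechet_derivative F (at q))" if q: "q \<in> U'" for q
    proof -
      note F' = smooth_on_has_derivative[OF smooth_F inB[OF q]]
      \<comment> \<open>\<open>\<phi>\<close> consists of the first two components of
        \<open>F\<close>, so injectivity of its derivative passes to that of
        \<open>F\<close>.\<close>
      have "((\<lambda>r. (fst (F r), fst (snd (F r)))) has_derivative (\<lambda>v. (fst (frechet_derivative F (at q) v),
          fst (snd (frechet_derivative F (at q) v))))) (at q)"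
        by (intro has_derivative_Pair has_derivative_fst has_derivative_snd F')
      moreover have "(\<lambda>r. (fst (F r), fst (snd (F r)))) = \<phi>"
        by (simp add: F_def \<phi>_def)
      ultimately have "(\<phi> has_derivative (\<lambda>v. (fst (frechet_derivative F (at q) v),
          fst (snd (frechet_derivative F (at q) v))))) (at q)"
        by simp
      note \<phi>F = frechet_derivative_at[OF this, symmetric]
      show ?thesis
      proof (rule injI)
        fix v w assume "frechet_derivative F (at q) v = frechet_derivative F (at q) w"
        then have "frechet_derivative \<phi> (at q) v = frechet_derivative \<phi> (at q) w"
          unfolding \<phi>F by simp
        then show "v = w" by (rule injD[OF inj'[OF q]])
      qed
    qed
    \<comment> \<open>The continuous inverse projects to the plane and then applies the inverse of
      \<open>\<phi>\<close>.\<close>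
    show "\<exists>G. homeomorphism U' (F ` U') F G"
    proof (intro exI homeomorphismI)
      show "continuous_on U' F"
        using smooth_on_continuous_on[OF smooth_F] U'(2) by (rule continuous_on_subset)
      show "continuous_on (F ` U') (\<lambda>w. inv_into U' \<phi> (fst w, fst (snd w)))"
        by (intro continuous_on_compose2[OF smooth_on_continuous_on[OF inv_smooth]] continuous_intros)
           (auto simp: F_def \<phi>_def)
      show "inv_into U' \<phi> (fst (F q), fst (snd (F q))) = q" if "q \<in> U'" for q
        using inv_\<phi>[OF that] by (simp add: F_def \<phi>_def)
      then show "F (inv_into U' \<phi> (fst w, fst (snd w))) = w" if "w \<in> F ` U'" for w
        using that by auto
      then show "(\<lambda>w. inv_into U' \<phi> (fst w, fst (snd w))) ` F ` U' \<subseteq> U'"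
        using inv_\<phi> by (auto simp: F_def \<phi>_def)
    qed auto
  qed
  have smooth_u: "smooth_on (\<phi> ` U') u"
    unfolding u_def
    by (rule smooth_on_compose[OF img _ inv_smooth smooth_on_subset[OF smooth(4) U'(2)]])
       (auto simp: inv_\<phi>)
  have diff_sin: "(\<lambda>r. sin (\<theta> r)) differentiable (at q)"
    and diff_cos: "(\<lambda>r. cos (\<theta> r)) differentiable (at q)" if "q \<in> U'" for q
    using smooth_on_differentiable[OF smooth_on_sin[OF B(1) smooth(1)] inB[OF that]]
      smooth_on_differentiable[OF smooth_on_cos[OF B(1) smooth(1)] inB[OF that]] .
  have N: "pushforward U' \<phi> P (\<phi> r) = (cos (\<theta> r), sin (\<theta> r))" if "r \<in> U'" for r
    using \<phi>P[OF inB[OF that]] by (simp add: push[OF that] deriv_along_def)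
  have div_N: "divergence (pushforward U' \<phi> P) (\<phi> q) = H q" if q: "q \<in> U'" for q
  proof -
    \<comment> \<open>The two terms with P \<theta> cancel; the rest is -(sin^2 + cos^2) V \<theta>,
      that is \<open>H q\<close>.\<close>
    note divergence[OF q diff_cos[OF q] diff_sin[OF q], of "pushforward U' \<phi> P", OF N, simplified]
    then show ?thesis
      using pythagoras[of "\<theta> q" "H q"] diff(1)[OF q]
      by (simp add: deriv_along_simps derivs(1) inB[OF q] algebra_simps)
  qed
  have div_DV: "divergence (pushforward U' \<phi> (\<lambda>r. D r *\<^sub>R V r)) (\<phi> q) = 2" if q: "q \<in> U'" for q
  proof -
    have DV: "pushforward U' \<phi> (\<lambda>r. D r *\<^sub>R V r) (\<phi> r) = (D r * sin (\<theta> r), - (D r * cos (\<theta> r)))"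
      if "r \<in> U'" for r
      using \<phi>V[OF inB[OF that]]
      by (simp add: push[OF that] deriv_along_def linear_scale[OF lin[OF inB[OF that]]])
    note d = diff(5)[OF q] diff_sin[OF q] diff_cos[OF q]
    have d': "(\<lambda>r. D r * sin (\<theta> r)) differentiable (at q)" "(\<lambda>r. D r * cos (\<theta> r)) differentiable (at q)"
      "(\<lambda>r. - (D r * cos (\<theta> r))) differentiable (at q)"
      by (intro differentiable_mult differentiable_minus d)+
    note divergence[OF q d'(1,3), of "pushforward U' \<phi> (\<lambda>r. D r *\<^sub>R V r)", OF DV, simplified]
    \<comment> \<open>The terms with P D and those with V \<theta> cancel in pairs, leaving V D + D
      (P \<theta>).\<close>
    then have "divergence (pushforward U' \<phi> (\<lambda>r. D r *\<^sub>R V r)) (\<phi> q) =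
        deriv_along V D q + D q * ((2 - deriv_along V D q) / D q)"
      using pythagoras[of "\<theta> q" "deriv_along V D q"] diff(1)[OF q] d d'(2)
        pythagoras[of "\<theta> q" "D q * deriv_along P \<theta> q"]
      by (simp add: deriv_along_simps derivs(1) inB[OF q] algebra_simps flip: derivs(2))
    then show ?thesis using D(2)[rule_format, OF inU[OF q]] by simp
  qed
  have "U' \<subseteq> U" using U'(2) B(4) by blast
  have "smooth_on U' \<theta>" "smooth_on U' z"
    using smooth_on_subset[OF _ U'(2)] smooth by blast+
  show thesis
    by (rule that[of U' \<phi> x y \<theta> z u])
       (fact | rule \<phi>_def | rule derivs[OF inB] unique ux uy N div_N div_DV u\<phi>[unfolded \<phi>_def]
          embedding[unfolded F_def]; assumption)+
qed

section \<open>From the coordinate identities to the two assertions\<close>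

theorem theoremH:
  fixes V P :: "real \<times> real \<Rightarrow> real \<times> real"
    and D H :: "real \<times> real \<Rightarrow> real"
    and U :: "(real \<times> real) set"
    and p :: "real \<times> real"
  assumes U: "open U" "p \<in> U"
    and V: "smooth_on U V" "\<forall>q\<in>U. V q \<noteq> 0"
    and D: "smooth_on U D" "\<forall>q\<in>U. D q > 0"
    and H: "smooth_on U H"
    and P: "smooth_on U P" "\<forall>q\<in>U. P q \<noteq> 0"
    and transversal: "\<forall>q\<in>U. transversal (V q) (P q)"
    and orientation: "\<forall>q\<in>U. same_orientation (V q, P q) ((1, 0), (0, 1))"
    and D_eq: "\<forall>q\<in>U. D q * deriv_along V (deriv_along V D) q =
        2 * (deriv_along V D q - 1) * (deriv_along V D q - 2) +
        ((H q)\<^sup>2 + deriv_along P H q) * (D q)\<^sup>2"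
    and Lie_eq: "\<forall>q\<in>U. lie_derivative V P q =
        - ((2 - deriv_along V D q) / D q) *\<^sub>R P q + H q *\<^sub>R V q"
  shows "\<exists>U' \<subseteq> U. open U' \<and> p \<in> U' \<and>
    (\<exists>(x :: real \<times> real \<Rightarrow> real) (y :: real \<times> real \<Rightarrow> real) (\<theta> :: real \<times> real \<Rightarrow> real)
        (N :: real \<times> real \<Rightarrow> real \<times> real) (\<phi> :: real \<times> real \<Rightarrow> real \<times> real).
      \<phi> = (\<lambda>q. (x q, y q)) \<and>
      diffeomorphism_onto_image U' \<phi> \<and> orientation_preserving_on U' \<phi> \<and>
      smooth_on U' \<theta> \<and>
      (\<forall>q\<in>U'. deriv_along V \<theta> q = - H q) \<and>
      (\<forall>q\<in>U'. deriv_along V x q = sin (\<theta> q)) \<and>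
      (\<forall>q\<in>U'. deriv_along V y q = - cos (\<theta> q)) \<and>
      (\<forall>q\<in>U'. deriv_along N x q = cos (\<theta> q) \<and> deriv_along N y q = sin (\<theta> q)) \<and>
      (\<forall>M :: real \<times> real \<Rightarrow> real \<times> real.
         (\<forall>q\<in>U'. deriv_along M x q = cos (\<theta> q) \<and> deriv_along M y q = sin (\<theta> q)) \<longrightarrow>
         (\<forall>q\<in>U'. M q = N q)) \<and>
      (\<forall>q\<in>U'. N q = P q) \<and>
      (\<forall>q\<in>U'. deriv_along N \<theta> q = (2 - deriv_along V D q) / D q) \<and>
      (\<exists>(z :: real \<times> real \<Rightarrow> real) (F :: real \<times> real \<Rightarrow> heisenberg) (u :: real \<times> real \<Rightarrow> real).
        smooth_on U' z \<and>
        F = (\<lambda>q. (x q, y q, z q)) \<and>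
        smooth_embedding_on U' F \<and>
        smooth_on (\<phi> ` U') u \<and>
        F ` U' = {(a, b, u (a, b)) | a b. (a, b) \<in> \<phi> ` U'} \<and>
        (\<forall>q\<in>U'. D q = sqrt ((partial_x u (\<phi> q) - y q)\<^sup>2 + (partial_y u (\<phi> q) + x q)\<^sup>2)) \<and>
        (\<forall>q\<in>U'. pushforward U' \<phi> N (\<phi> q) =
           (1 / D q) *\<^sub>R (partial_x u (\<phi> q) - y q, partial_y u (\<phi> q) + x q)) \<and>
        (\<forall>q\<in>U'. divergence (pushforward U' \<phi> N) (\<phi> q) = H q) \<and>
        (\<forall>q\<in>U'. divergence (pushforward U' \<phi> (\<lambda>r. D r *\<^sub>R V r)) (\<phi> q) = 2)))"
proof -
  obtain U' x y \<theta> \<phi> z u where U': "U' \<subseteq> U" "open U'" "p \<in> U'" and \<phi>: "\<phi> = (\<lambda>q. (x q, y q))"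
    and smooth: "diffeomorphism_onto_image U' \<phi>" "orientation_preserving_on U' \<phi>"
      "smooth_on U' \<theta>" "smooth_on U' z" "smooth_on (\<phi> ` U') u"
      "smooth_embedding_on U' (\<lambda>q. (x q, y q, z q) :: heisenberg)"
    and derivs: "\<And>q. q \<in> U' \<Longrightarrow> deriv_along V \<theta> q = - H q"
      "\<And>q. q \<in> U' \<Longrightarrow> deriv_along P \<theta> q = (2 - deriv_along V D q) / D q"
      "\<And>q. q \<in> U' \<Longrightarrow> deriv_along V x q = sin (\<theta> q)"
      "\<And>q. q \<in> U' \<Longrightarrow> deriv_along P x q = cos (\<theta> q)"
      "\<And>q. q \<in> U' \<Longrightarrow> deriv_along V y q = - cos (\<theta> q)"
      "\<And>q. q \<in> U' \<Longrightarrow> deriv_along P y q = sin (\<theta> q)"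
    and unique: "\<And>M q. q \<in> U' \<Longrightarrow> deriv_along M x q = cos (\<theta> q) \<Longrightarrow>
      deriv_along M y q = sin (\<theta> q) \<Longrightarrow> M q = P q"
    and u: "\<And>q. q \<in> U' \<Longrightarrow> u (x q, y q) = z q"
    and ux: "\<And>q. q \<in> U' \<Longrightarrow> partial_x u (\<phi> q) - y q = D q * cos (\<theta> q)"
    and uy: "\<And>q. q \<in> U' \<Longrightarrow> partial_y u (\<phi> q) + x q = D q * sin (\<theta> q)"
    and N: "\<And>q. q \<in> U' \<Longrightarrow> pushforward U' \<phi> P (\<phi> q) = (cos (\<theta> q), sin (\<theta> q))"
    and div: "\<And>q. q \<in> U' \<Longrightarrow> divergence (pushforward U' \<phi> P) (\<phi> q) = H q"
      "\<And>q. q \<in> U' \<Longrightarrow> divergence (pushforward U' \<phi> (\<lambda>r. D r *\<^sub>R V r)) (\<phi> q) = 2"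
    by (rule heisenberg_graph_coordinates[OF U V(1) D H P(1) orientation D_eq Lie_eq]) blast
  define F :: "real \<times> real \<Rightarrow> heisenberg" where "F = (\<lambda>q. (x q, y q, z q))"
  have embedding: "smooth_embedding_on U' F"
    unfolding F_def by fact
  have graph: "F ` U' = {(a, b, u (a, b)) | a b. (a, b) \<in> \<phi> ` U'}"
    using u by (force simp: F_def \<phi>)
  have D_pos: "D q > 0" if "q \<in> U'" for q
    using D(2) U'(1) that by blast
  have D_norm: "D q = sqrt ((partial_x u (\<phi> q) - y q)\<^sup>2 + (partial_y u (\<phi> q) + x q)\<^sup>2)"
    if q: "q \<in> U'" for q
  proof -
    have "(D q * cos (\<theta> q))\<^sup>2 + (D q * sin (\<theta> q))\<^sup>2 = (D q)\<^sup>2"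
      by (simp add: power_mult_distrib flip: distrib_left)
    then show ?thesis using D_pos[OF q] by (simp add: ux[OF q] uy[OF q])
  qed
  have N_eq: "pushforward U' \<phi> P (\<phi> q) = (1 / D q) *\<^sub>R (partial_x u (\<phi> q) - y q, partial_y u (\<phi> q) + x q)"
    if q: "q \<in> U'" for q
    using D_pos[OF q] by (simp add: N[OF q] ux[OF q] uy[OF q])
  \<comment> \<open>The witness for \<open>N\<close> is \<open>P\<close> itself;
    \<open>unique\<close> shows that no other field has the prescribed derivatives of
    \<open>x\<close> and \<open>y\<close>.\<close>
  show ?thesis
    by (rule exI[of _ U'], intro conjI, fact, fact, fact,
        rule exI[of _ x], rule exI[of _ y], rule exI[of _ \<theta>], rule exI[of _ P], rule exI[of _ \<phi>])
       (fact | rule F_def refl | rule D_norm N_eq div derivs; assumption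
        | rule unique; blast
        | rule conjI ballI allI impI | rule exI[of _ z], rule exI[of _ F], rule exI[of _ u])+
qed

end
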